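(* Let $n,r$ be positive integers with $\max\{r,n\}>1$, and set $D_{n,r}(t,z):=(1-t)^{n}+zt^{r}$. Let $\{P_m(z)\}_{m=0}^\infty$ be the sequence of polynomials in $z$ generated by the relation $$\sum_{m=0}^{\infty}P_{m}(z)t^{m}=\frac{1}{D_{n,r}(t,z)},$$ and let $$I=\begin{cases}(0,\infty) & \text{if } n,r\ge 2,\\ \left(0,\ n^{n}/(n-1)^{n-1}\right) & \text{if } r=1,\\ \left((r-1)^{r-1}/r^{r},\ \infty\right) & \text{if } n=1.\end{cases}$$ Then for all sufficiently large $m$ (that is, for all $m\ge M$ for some $M$, which may depend on $n$ and $r$), all zeros of $P_m(z)$ lie on the real interval $I$. Furthermore, if $\mathcal{Z}(P_m)$ denotes the set of zeros of $P_m(z)$, then $\bigcup_{m\gg 1}\mathcal{Z}(P_{m})$, the union taken over all such large $m$ (i.e. over all $m\geq M$), is dense in $I$.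
   Context: The generating relation is an identity of formal power series in $t$ with coefficients in $\mathbb{R}[z]$. "Zeros" means all complex zeros of $P_m$. *)

theory Defs
  imports "HOL-Analysis.Analysis" "HOL-Computational_Algebra.Computational_Algebra"
begin

(* Formal power series in t (fps_X) whose coefficients are real polynomials in z = [:0, 1:]. *)
definition gen_denom :: "nat \<Rightarrow> nat \<Rightarrow> real poly fps" where
  "gen_denom n r = (1 - fps_X) ^ n + fps_const [:0, 1:] * fps_X ^ r"

(* Since "real poly" is not a field, the library has no division on "real poly fps"; the series
   1 / gen_denom n r is the inverse of gen_denom n r in this commutative ring. *)
definition generated_by :: "nat \<Rightarrow> nat \<Rightarrow> (nat \<Rightarrow> real poly) \<Rightarrow> bool" where
  "generated_by n r P \<longleftrightarrow> Abs_fps P * gen_denom n r = 1"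

lemma generated_by_ex1:
  assumes "r > 0"
  shows "\<exists>!P. generated_by n r P"
proof -
  have "gen_denom n r $ 0 * 1 = 1"
    using assms by (simp add: gen_denom_def fps_nth_power_0)
  then have inv: "gen_denom n r * fps_right_inverse (gen_denom n r) 1 = 1"
    by (rule fps_right_inverse)
  show ?thesis
  proof (rule ex1I)
    show "generated_by n r (fps_nth (fps_right_inverse (gen_denom n r) 1))"
      using inv unfolding generated_by_def by (simp only: fps_nth_inverse mult.commute[of _ "gen_denom n r"])
  next
    fix P assume "generated_by n r P"
    then have "Abs_fps P * gen_denom n r = 1" by (simp add: generated_by_def)
    then have "Abs_fps P * gen_denom n r * fps_right_inverse (gen_denom n r) 1 = fps_right_inverse (gen_denom n r) 1"
      by simp
    then have "Abs_fps P = fps_right_inverse (gen_denom n r) 1"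
      unfolding mult.assoc inv by simp
    then have "fps_nth (Abs_fps P) = fps_nth (fps_right_inverse (gen_denom n r) 1)"
      by (rule arg_cong)
    then show "P = fps_nth (fps_right_inverse (gen_denom n r) 1)"
      by (simp add: fun_eq_iff)
  qed
qed

definition complex_zeros :: "real poly \<Rightarrow> complex set" where
  "complex_zeros p = {z. poly (map_poly complex_of_real p) z = 0}"

(* Only meant for n, r > 0, not both 1. *)
definition zero_interval :: "nat \<Rightarrow> nat \<Rightarrow> real set" where
  "zero_interval n r =
    (if n \<ge> 2 \<and> r \<ge> 2 then {0<..}
     else if r = 1 then {0<..<real n ^ n / real (n - 1) ^ (n - 1)}
     else {real (r - 1) ^ (r - 1) / real r ^ r<..})"

end

theory Submission
  imports Defs "HOL-Complex_Analysis.Complex_Analysis" "HOL-Real_Asymp.Real_Asymp"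
begin

text \<open>
  The zeros of every single \<open>P\<^sub>m\<close> lie on the interval, so \<open>M = 0\<close> is possible.

  Realness. Fix a value \<open>z\<close> and put \<open>x = - z\<close>. The coefficients \<open>q\<^bsub>j,m\<^esub>\<close> of \<open>(1 - t)\<^sup>j / D(t, z)\<close>
  satisfy \<open>q\<^bsub>j,m\<^esub> = q\<^bsub>j,m-1\<^esub> + q\<^bsub>j+1,m\<^esub>\<close>, and \<open>q\<^bsub>n,m\<^esub> = x q\<^bsub>0,m-r\<^esub>\<close> for \<open>m \<ge> 1\<close>: only additions and
  one multiplication by \<open>x\<close>. If \<open>Im x > 0\<close>, these operations preserve a cyclic ordering of the arguments
  of \<open>q\<^bsub>0,m-r\<^esub>, \<dots>, q\<^bsub>0,m\<^esub>, q\<^bsub>1,m\<^esub>, \<dots>, q\<^bsub>n-1,m\<^esub>\<close> within a turn by the argument of \<open>x\<close>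
  (\<open>arg_between_coeffs\<close>), and two terms so ordered cancel only if both vanish. Hence \<open>P\<^sub>m(z) \<noteq> 0\<close> for nonreal \<open>z\<close>
  (\<open>coeff_nonzero_upper\<close> and complex conjugation). For real \<open>z \<le> 0\<close> everything is positive. The sharper endpoints
  for \<open>n = 1\<close> and \<open>r = 1\<close> follow from comparison with a geometric solution of the recursion
  (\<open>coeff_pos_one\<close>, \<open>coeff_nonzero_linear\<close>).

  Density. For \<open>z\<close> in the interval, \<open>D(t, z)\<close> has a root \<open>u\<close> with argument \<open>\<theta>\<close> for which \<open>1 - u\<close> has
  argument \<open>- \<phi>\<close>, where \<open>\<theta>, \<phi> > 0\<close> and \<open>r \<theta> + n \<phi> = pi\<close> (\<open>param_surj\<close>). The roots \<open>u\<close> and \<open>cnj u\<close> are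
  simple, and all others have larger modulus (\<open>apex_dominant\<close>). So \<open>P\<^sub>m(z) \<bar>u\<bar>\<^sup>m\<close> is asymptotically
  a nontrivial oscillation of frequency \<open>\<theta>\<close> (\<open>generated_asymptotics\<close>). Distinct \<open>z\<close> have distinct
  \<open>\<theta>\<close>, and two oscillations with distinct frequencies in \<open>(0, pi)\<close> cannot have a nonnegative product for
  every \<open>m\<close>, as a comparison of means shows (\<open>oscillating_products_negative\<close>). Therefore between any two points
  of the interval some \<open>P\<^sub>m\<close> changes sign.
\<close>

section \<open>Coefficients of powers of 1 - t times the generating function and realness of the zeros\<close>

text \<open>
  The coefficient of \<open>t\<^sup>m\<close> in \<open>(1 - t)\<^sup>j F(t)\<close>. For \<open>F = 1 / ((1 - t)\<^sup>n + z t\<^sup>r)\<close> these numbers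
  with \<open>0 \<le> j \<le> n\<close> interpolate between the coefficients of \<open>F\<close> (\<open>j = 0\<close>) and a delayed multiple of
  them (\<open>j = n\<close>), so that the recursion becomes a sequence of additions of two terms.
\<close>
definition pow_coeff :: "'a::comm_ring_1 fps \<Rightarrow> nat \<Rightarrow> nat \<Rightarrow> 'a" where
  "pow_coeff F j m = fps_nth ((1 - fps_X) ^ j * F) m"

lemma pow_coeff_0_left: "pow_coeff F 0 m = fps_nth F m"
  by (simp add: pow_coeff_def)

lemma pow_coeff_0_right: "pow_coeff F j 0 = fps_nth F 0"
  by (simp add: pow_coeff_def fps_nth_power_0)

lemma pow_coeff_Suc:
  "pow_coeff F j (Suc m) = pow_coeff F j m + pow_coeff F (Suc j) (Suc m)"
proof -
  define G where "G = (1 - fps_X) ^ j * F"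
  have "(1 - fps_X) ^ Suc j * F = G - fps_X * G"
    by (simp add: G_def algebra_simps)
  then have "pow_coeff F (Suc j) (Suc m) = fps_nth G (Suc m) - fps_nth G m"
    by (simp add: pow_coeff_def)
  then show ?thesis
    by (simp add: pow_coeff_def G_def)
qed

text \<open>The series \<open>t\<^sup>r F(t)\<close> supplies the coefficient with index \<open>Suc m - r\<close>, read as 0 if \<open>Suc m < r\<close>.\<close>
lemma pow_coeff_top:
  assumes "F * ((1 - fps_X) ^ n + fps_const z * fps_X ^ r) = 1"
  shows "pow_coeff F n (Suc m) = - z * fps_nth (fps_X ^ r * F) (Suc m)"
proof -
  have "(1 - fps_X) ^ n * F = 1 - fps_const z * (fps_X ^ r * F)"
    using assms by (simp add: algebra_simps)
  then show ?thesis
    by (simp add: pow_coeff_def)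
qed

lemma nth_0_eq_1:
  fixes F :: "'a::comm_ring_1 fps"
  assumes "F * ((1 - fps_X) ^ n + fps_const z * fps_X ^ r) = 1" "r > 0"
  shows "fps_nth F 0 = 1"
proof -
  have "fps_nth (F * ((1 - fps_X) ^ n + fps_const z * fps_X ^ r)) 0 = 1"
    using assms(1) by simp
  then show ?thesis
    using assms(2) by (simp add: fps_nth_power_0 power_0_left)
qed

text \<open>
  For nonzero \<open>u\<close>, \<open>v\<close> and \<open>x\<close> in the upper half-plane this says that \<open>v\<close> lies in the closed convex
  cone spanned by \<open>u\<close> and \<open>x u\<close>. The relation is a pointwise form of the condition \<open>Im (g / f) \<ge> 0\<close> on
  the upper half-plane, which expresses that the zeros of two real polynomials \<open>f\<close> and \<open>g\<close> interlace.
  It is preserved by sums in either argument, and the zero vector is related to everything.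
\<close>
definition arg_between :: "complex \<Rightarrow> complex \<Rightarrow> complex \<Rightarrow> bool" where
  "arg_between x u v \<longleftrightarrow> Im (cnj u * v) \<ge> 0 \<and> Im (cnj v * (x * u)) \<ge> 0"

lemma arg_between_zero [simp]: "arg_between x 0 v" "arg_between x u 0"
  by (auto simp: arg_between_def)

lemma arg_between_refl: "Im x \<ge> 0 \<Longrightarrow> arg_between x u u"
proof -
  assume "Im x \<ge> 0"
  moreover have "Im (cnj u * (x * u)) = Im x * (Re u ^ 2 + Im u ^ 2)"
    by (simp add: algebra_simps power2_eq_square)
  ultimately show ?thesis
    by (simp add: arg_between_def algebra_simps)
qed

lemma arg_between_add_right:
  "arg_between x u v \<Longrightarrow> arg_between x u w \<Longrightarrow> arg_between x u (v + w)"
  by (auto simp: arg_between_def algebra_simps)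

lemma arg_between_add_left:
  "arg_between x u w \<Longrightarrow> arg_between x v w \<Longrightarrow> arg_between x (u + v) w"
  by (auto simp: arg_between_def algebra_simps)

lemma arg_between_rotate:
  assumes "arg_between x u v"
  shows "arg_between x v (x * u)"
proof -
  have "Im (cnj (x * u) * (x * v)) = (Re x ^ 2 + Im x ^ 2) * Im (cnj u * v)"
    by (simp add: algebra_simps power2_eq_square)
  then show ?thesis
    using assms by (simp add: arg_between_def)
qed

lemma arg_between_sum_eq_0:
  assumes "arg_between x u v" "Im x > 0" "u + v = 0"
  shows "u = 0"
proof -
  have "v = - u"
    using assms(3) by (simp add: eq_neg_iff_add_eq_0 add.commute)
  moreover have "Im (cnj u * (x * u)) = Im x * (Re u ^ 2 + Im u ^ 2)"
    by (simp add: algebra_simps power2_eq_square)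
  ultimately have "Im x * (Re u ^ 2 + Im u ^ 2) \<le> 0"
    using assms(1) by (simp add: arg_between_def)
  then have "Re u ^ 2 + Im u ^ 2 \<le> 0"
    using assms(2) by (simp add: mult_le_0_iff)
  then show ?thesis
    by (simp add: complex_eq_iff sum_power2_le_zero_iff)
qed

text \<open>
  Write \<open>p\<^sub>i\<close> for the coefficients of \<open>F\<close> (0 for negative \<open>i\<close>) and \<open>q\<^sub>j\<^sub>,\<^sub>m\<close> for those of
  \<open>(1 - t)\<^sup>j F\<close>. The chain \<open>p\<^bsub>m-r\<^esub>, \<dots>, p\<^bsub>m-1\<^esub>, q\<^bsub>0,m\<^esub>, \<dots>, q\<^bsub>n-1,m\<^esub>\<close> is ordered by
  \<open>arg_between x\<close>: each term is related to itself and to all later ones. In the passage from \<open>m\<close> to \<open>m + 1\<close> the first term is removed, and, starting from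
  \<open>x p\<^bsub>m+1-r\<^esub>\<close>, which may be appended to the chain by rotation, each new term is the sum of two
  terms that are neighbours once the superseded terms are dropped. Such a sum fits between its summands.
  The conclusion is the part of this induction that compares the chains for \<open>m\<close> and \<open>m + 1\<close>.
\<close>
lemma arg_between_coeffs:
  fixes F :: "complex fps"
  assumes eq: "F * ((1 - fps_X) ^ n + fps_const (- x) * fps_X ^ r) = 1"
    and n: "n > 0" and r: "r > 0" and x: "Im x > 0"
    and j: "j \<le> j'" "j < n" "j' \<le> n"
  shows "arg_between x (pow_coeff F j m) (pow_coeff F j' (Suc m))"
proof -
  define q where "q = pow_coeff F"
  \<comment> \<open>the coefficients of F with their index shifted by r: p i belongs to the index i - r\<close>
  define p where "p = fps_nth (fps_X ^ r * F)"
  have refl: "arg_between x u u" for u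
    using arg_between_refl x by auto
  have p_shift: "p (m + r) = q 0 m" for m
    by (simp add: p_def q_def pow_coeff_0_left fps_X_power_mult_nth)
  have top: "q n (Suc m) = x * p (Suc m)" for m
    using pow_coeff_top[OF eq] by (simp add: q_def p_def)
  have rec: "q j (Suc m) = q j m + q (Suc j) (Suc m)" for j m
    unfolding q_def by (rule pow_coeff_Suc)
  \<comment> \<open>The statements A, B and C say that the whole chain at time m is ordered; E compares it with
    the chain at time m + 1.\<close>
  define A where "A m \<longleftrightarrow> (\<forall>i i'. m \<le> i \<longrightarrow> i \<le> i' \<longrightarrow> i' \<le> m + r \<longrightarrow> arg_between x (p i) (p i'))" for m
  define B where "B m \<longleftrightarrow> (\<forall>i j. m \<le> i \<longrightarrow> i \<le> m + r \<longrightarrow> j < n \<longrightarrow> arg_between x (p i) (q j m))" for m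
  define C where "C m \<longleftrightarrow> (\<forall>j j'. j \<le> j' \<longrightarrow> j' < n \<longrightarrow> arg_between x (q j m) (q j' m))" for m
  define E where "E m \<longleftrightarrow> (\<forall>j j'. j \<le> j' \<longrightarrow> j < n \<longrightarrow> j' \<le> n \<longrightarrow> arg_between x (q j m) (q j' (Suc m)))" for m
  have stepE: "E m" if "A m" "B m" "C m" for m
    unfolding E_def
  proof (intro allI impI)
    fix j j' assume j: "j \<le> j'" "j < n" "j' \<le> n"
    from j(3,1) show "arg_between x (q j m) (q j' (Suc m))"
    proof (induction j' rule: inc_induct)
      case base
      have "arg_between x (p (Suc m)) (q j m)"
        using \<open>B m\<close> r j(2) by (simp add: B_def)
      then show ?case
        unfolding top by (rule arg_between_rotate)
    next
      case (step k)
      then show ?case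
        unfolding rec[of k] using \<open>C m\<close> by (intro arg_between_add_right) (auto simp: C_def)
    qed
  qed
  have inv: "A m \<and> B m \<and> C m"
  proof (induction m)
    case 0
    have "p i = 0" if "i < r" for i
      using that by (simp add: p_def fps_X_power_mult_nth)
    moreover have q0: "q j 0 = 1" for j
      using nth_0_eq_1[OF eq r] by (simp add: q_def pow_coeff_0_right)
    moreover have "p r = 1"
      using p_shift[of 0] q0 by simp
    ultimately have "p i = 0 \<or> p i = 1" if "i \<le> r" for i
      using that le_neq_implies_less by blast
    moreover have "p i = 0 \<or> i = r" if "i \<le> r" for i
      using that \<open>\<And>i. i < r \<Longrightarrow> p i = 0\<close> le_neq_implies_less by blast
    ultimately show ?case
      unfolding A_def B_def C_def using refl q0
      by (metis add_0 arg_between_zero le_antisym order_trans)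
  next
    case (Suc m)
    then have IH: "A m" "B m" "C m"
      by auto
    have "E m"
      using stepE IH by blast
    have pq: "arg_between x (p i) (q j (Suc m))" if i: "Suc m \<le> i" "i \<le> m + r" and "j \<le> n" for i j
      using \<open>j \<le> n\<close>
    proof (induction j rule: inc_induct)
      case base
      have "arg_between x (p (Suc m)) (p i)"
        using \<open>A m\<close> i by (simp add: A_def)
      then show ?case
        unfolding top by (rule arg_between_rotate)
    next
      case (step k)
      then show ?case
        unfolding rec[of k] using \<open>B m\<close> i by (intro arg_between_add_right) (auto simp: B_def)
    qed
    have C': "C (Suc m)"
      unfolding C_def
    proof (intro allI impI)
      fix j j' assume j: "j \<le> j'" "j' < n"
      from j(1) show "arg_between x (q j (Suc m)) (q j' (Suc m))"
      proof (induction j rule: inc_induct)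
        case base
        show ?case by (rule refl)
      next
        case (step k)
        then show ?case
          unfolding rec[of k] using \<open>E m\<close> j(2)
          by (intro arg_between_add_left) (auto simp: E_def)
      qed
    qed
    have last: "p (Suc (m + r)) = q 0 (Suc m)"
      using p_shift[of "Suc m"] by simp
    have B': "B (Suc m)"
      unfolding B_def
    proof (intro allI impI)
      fix i j assume "Suc m \<le> i" "i \<le> Suc m + r" "j < n"
      then show "arg_between x (p i) (q j (Suc m))"
        using pq[of i j] C' last by (cases "i = Suc (m + r)") (auto simp: C_def)
    qed
    have A': "A (Suc m)"
      unfolding A_def
    proof (intro allI impI)
      fix i i' assume "Suc m \<le> i" "i \<le> i'" "i' \<le> Suc m + r"
      then show "arg_between x (p i) (p i')"
        using B' n last \<open>A m\<close>
        by (cases "i' = Suc (m + r)") (auto simp: A_def B_def)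
    qed
    show ?case
      using A' B' C' by blast
  qed
  then have "E m"
    using stepE by blast
  then show ?thesis
    using j by (simp add: E_def q_def)
qed

text \<open>
  Each coefficient is the sum of its predecessor and of a number related to it, and such a sum
  vanishes only if both terms do.
\<close>
lemma coeff_nonzero_upper:
  fixes F :: "complex fps"
  assumes eq: "F * ((1 - fps_X) ^ n + fps_const (- x) * fps_X ^ r) = 1"
    and n: "n > 0" and r: "r > 0" and x: "Im x > 0"
  shows "fps_nth F m \<noteq> 0"
proof (induction m)
  case 0
  then show ?case
    using nth_0_eq_1[OF eq r] by simp
next
  case (Suc m)
  have "arg_between x (pow_coeff F 0 m) (pow_coeff F 1 (Suc m))"
    using arg_between_coeffs[OF eq n r x, of 0 1 m] n by simp
  then have "pow_coeff F 0 m + pow_coeff F 1 (Suc m) \<noteq> 0"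
    using arg_between_sum_eq_0[OF _ x] Suc by (metis pow_coeff_0_left)
  then show ?case
    using pow_coeff_Suc[of F 0 m] by (simp add: pow_coeff_0_left)
qed

section \<open>Real parameters outside the interval\<close>

lemma coeff_pos_nonpos:
  fixes F :: "real fps"
  assumes eq: "F * ((1 - fps_X) ^ n + fps_const z * fps_X ^ r) = 1"
    and n: "n > 0" and r: "r > 0" and z: "z \<le> 0"
  shows "fps_nth F m > 0"
proof -
  have "\<forall>j<n. pow_coeff F j m > 0"
  proof (induction m rule: less_induct)
    case (less m)
    show ?case
    proof (cases m)
      case 0
      then show ?thesis
        using nth_0_eq_1[OF eq r] by (simp add: pow_coeff_0_right)
    next
      case (Suc k)
      have "fps_nth F (m - r) > 0"
        using less.IH[of "m - r"] n r Suc by (simp flip: pow_coeff_0_left)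
      then have "fps_nth (fps_X ^ r * F) m \<ge> 0"
        by (simp add: fps_X_power_mult_nth)
      then have top: "pow_coeff F n m \<ge> 0"
        using pow_coeff_top[OF eq, of k] z Suc by (simp add: mult_nonpos_nonneg)
      have pos: "pow_coeff F j m \<ge> 0 \<and> (j < n \<longrightarrow> pow_coeff F j m > 0)" if "j \<le> n" for j
        using that
      proof (induction j rule: inc_induct)
        case base
        then show ?case
          using top by simp
      next
        case (step i)
        have "pow_coeff F i k > 0"
          using less.IH[of k] Suc step by auto
        then show ?case
          using step.IH Suc pow_coeff_Suc[of F i k] by auto
      qed
      then show ?thesis
        by auto
    qed
  qed
  then show ?thesis
    using n by (simp flip: pow_coeff_0_left)
qed

text \<open>
  For \<open>n = 1\<close> the recursion is \<open>p\<^bsub>m+1\<^esub> = p\<^sub>m - z p\<^bsub>m+1-r\<^esub>\<close>, with 0 for negative indices.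
  On the stated range of \<open>z\<close> the point
  \<open>t = r / (r - 1)\<close> satisfies \<open>z t\<^sup>r \<le> t - 1\<close>, which makes the bound \<open>p\<^bsub>m+1\<^esub> \<ge> p\<^sub>m / t\<close> inductive.
\<close>
lemma coeff_pos_one:
  fixes F :: "real fps"
  assumes eq: "F * ((1 - fps_X) ^ 1 + fps_const z * fps_X ^ r) = 1"
    and r: "r \<ge> 2" and z: "0 \<le> z" "z \<le> real (r - 1) ^ (r - 1) / real r ^ r"
  shows "fps_nth F m > 0"
proof -
  \<comment> \<open>the maximum point of \<open>(t - 1) / t\<^sup>r\<close>\<close>
  define t where "t = real r / real (r - 1)"
  define f where "f = fps_nth F"
  have t1: "t > 1" and t: "t > 0"
    using r by (auto simp: t_def field_simps)
  have "z * t ^ (r - 1) \<le> real (r - 1) ^ (r - 1) / real r ^ r * t ^ (r - 1)"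
    using z t by (intro mult_right_mono) auto
  also have "\<dots> = 1 / real r"
    using r power_Suc[of "real r" "r - 1"] by (simp add: t_def power_divide field_simps)
  also have "\<dots> = 1 - 1 / t"
    using r by (simp add: t_def field_simps of_nat_diff)
  finally have zt: "z * t ^ (r - 1) \<le> 1 - 1 / t" .
  have rec: "f (Suc m) = f m - z * (if Suc m < r then 0 else f (Suc m - r))" for m
    using pow_coeff_top[OF eq, of m] pow_coeff_Suc[of F 0 m]
    by (simp add: f_def pow_coeff_0_left fps_X_power_mult_nth)
  have "\<forall>k\<le>m. 0 < f k \<and> f k \<le> t ^ (m - k) * f m"
  proof (induction m)
    case 0
    then show ?case
      using nth_0_eq_1[OF eq] r by (simp add: f_def)
  next
    case (Suc m)
    then have fm: "f m > 0"
      by blast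
    have "(if Suc m < r then 0 else f (Suc m - r)) \<le> t ^ (r - 1) * f m"
    proof (cases "Suc m < r")
      case True
      then show ?thesis
        using t fm by simp
    next
      case False
      then have "m - (Suc m - r) = r - 1" "Suc m - r \<le> m"
        using r by auto
      then show ?thesis
        using Suc False by metis
    qed
    then have "z * (if Suc m < r then 0 else f (Suc m - r)) \<le> z * (t ^ (r - 1) * f m)"
      using z by (intro mult_left_mono)
    also have "\<dots> \<le> (1 - 1 / t) * f m"
      using zt fm by (simp only: mult.assoc[symmetric] mult_right_mono less_imp_le)
    finally have ge: "f m / t \<le> f (Suc m)"
      unfolding rec by (simp add: algebra_simps)
    then have pos: "f (Suc m) > 0"
      using fm t by (smt (verit) divide_pos_pos)
    have "f k \<le> t ^ (Suc m - k) * f (Suc m)" if "k \<le> m" for k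
    proof -
      have "f k \<le> t ^ (m - k) * f m"
        using Suc that by blast
      also have "\<dots> \<le> t ^ (m - k) * (t * f (Suc m))"
        using ge t by (intro mult_left_mono) (auto simp: field_simps)
      finally show ?thesis
        using that by (simp add: Suc_diff_le mult.assoc mult.left_commute)
    qed
    then show ?case
      using Suc pos by (auto simp: le_Suc_eq)
  qed
  then show ?thesis
    by (simp add: f_def)
qed

text \<open>
  For \<open>r = 1\<close> the coefficients alternate in sign. With \<open>a\<^sub>j\<^sub>,\<^sub>m = (- 1)\<^sup>m q\<^sub>j\<^sub>,\<^sub>m\<close> the inductive statement is
  \<open>0 < a\<^sub>0\<^sub>,\<^sub>m\<close> and \<open>a\<^sub>j\<^sub>,\<^sub>m \<le> Q\<^sup>j a\<^sub>0\<^sub>,\<^sub>m\<close>, where \<open>s = Q - 1 = 1 / (n - 1)\<close> minimises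
  \<open>(1 + s)\<^sup>n / s\<close>; the minimum is the lower bound imposed on \<open>z\<close>.
\<close>
lemma coeff_nonzero_linear:
  fixes F :: "real fps"
  assumes eq: "F * ((1 - fps_X) ^ n + fps_const z * fps_X ^ 1) = 1"
    and n: "n \<ge> 2" and z: "z \<ge> real n ^ n / real (n - 1) ^ (n - 1)"
  shows "fps_nth F m \<noteq> 0"
proof -
  define Q where "Q = real n / real (n - 1)"
  define a where "a j m = (- 1) ^ m * pow_coeff F j m" for j m
  have Q1: "Q > 1" and Qn: "Q - 1 = 1 / real (n - 1)"
    using n by (auto simp: Q_def field_simps of_nat_diff)
  have "Q ^ n / (Q - 1) = real n ^ n / real (n - 1) ^ (n - 1)"
    using n power_Suc[of "real (n - 1)" "n - 1"] unfolding Qn by (simp add: Q_def power_divide)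
  then have zQ: "Q ^ n / (Q - 1) \<le> z"
    using z by simp
  have rec: "a j (Suc m) = a (Suc j) (Suc m) - a j m" for j m
    using pow_coeff_Suc[of F j m] by (simp add: a_def algebra_simps)
  have top: "a n (Suc m) = z * a 0 m" for m
    using pow_coeff_top[OF eq, of m] by (simp add: a_def pow_coeff_0_left)
  have "0 < a 0 m \<and> (\<forall>j<n. a j m \<le> Q ^ j * a 0 m)"
  proof (induction m)
    case 0
    then show ?case
      using nth_0_eq_1[OF eq] Q1 by (simp add: a_def pow_coeff_0_right)
  next
    case (Suc m)
    have lower: "Q ^ j / (Q - 1) * a 0 m \<le> a j (Suc m)" if "j \<le> n" for j
      using that
    proof (induction j rule: inc_induct)
      case base
      show ?case
        unfolding top using zQ Suc by (intro mult_right_mono) auto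
    next
      case (step i)
      have "Q ^ i / (Q - 1) = Q ^ Suc i / (Q - 1) - Q ^ i"
        using Q1 by (simp add: field_simps)
      then have "Q ^ i / (Q - 1) * a 0 m = Q ^ Suc i / (Q - 1) * a 0 m - Q ^ i * a 0 m"
        by (simp add: left_diff_distrib)
      also have "\<dots> \<le> a (Suc i) (Suc m) - a i m"
        using step Suc by (intro diff_mono) auto
      finally show ?case
        by (simp add: rec[of i])
    qed
    have "Q ^ 0 / (Q - 1) * a 0 m > 0"
      using Suc Q1 by simp
    then have pos: "a 0 (Suc m) > 0"
      using lower[of 0] by simp
    have step: "a (Suc j) (Suc m) \<le> Q * a j (Suc m)" if "j < n" for j
    proof -
      have "a j m / (Q - 1) \<le> Q ^ j / (Q - 1) * a 0 m"
        using Suc that Q1 by (simp add: divide_right_mono)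
      then have "a j m / (Q - 1) \<le> a j (Suc m)"
        using lower[of j] that by simp
      then have "a j m \<le> (Q - 1) * a j (Suc m)"
        using Q1 by (simp add: field_simps)
      then have "a j m \<le> Q * a j (Suc m) - a j (Suc m)"
        by (simp add: left_diff_distrib)
      then show ?thesis
        using rec[of j m] by linarith
    qed
    have "a j (Suc m) \<le> Q ^ j * a 0 (Suc m)" if "j < n" for j
      using that
    proof (induction j)
      case 0
      then show ?case by simp
    next
      case (Suc j)
      have "a (Suc j) (Suc m) \<le> Q * a j (Suc m)"
        using step Suc by simp
      also have "\<dots> \<le> Q * (Q ^ j * a 0 (Suc m))"
        using Suc Q1 by (intro mult_left_mono) auto
      finally show ?case by (simp add: mult.assoc)
    qed
    with pos show ?case by blast
  qed
  then show ?thesis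
    by (auto simp: a_def pow_coeff_0_left)
qed

section \<open>The root of the denominator given by a triangle\<close>

text \<open>
  The apex of the triangle on the base from 0 to 1 whose angles at 0 and 1 are \<open>\<theta>\<close> and \<open>\<phi>\<close>; by the
  law of sines its distances from 0 and 1 are \<open>sin \<phi> / sin (\<theta> + \<phi>)\<close> and \<open>sin \<theta> / sin (\<theta> + \<phi>)\<close>.
\<close>
definition apex :: "real \<Rightarrow> real \<Rightarrow> complex" where
  "apex \<theta> \<phi> = of_real (sin \<phi> / sin (\<theta> + \<phi>)) * cis \<theta>"

text \<open>The modulus of \<open>(1 - t)\<^sup>n / t\<^sup>r\<close> at the apex \<open>t\<close>.\<close>
definition param :: "nat \<Rightarrow> nat \<Rightarrow> real \<Rightarrow> real \<Rightarrow> real" where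
  "param n r \<theta> \<phi> = (sin \<theta> / sin (\<theta> + \<phi>)) ^ n / (sin \<phi> / sin (\<theta> + \<phi>)) ^ r"

text \<open>The angles for which, if \<open>\<theta> + \<phi> < pi\<close>, \<open>(1 - t)\<^sup>n / t\<^sup>r\<close> has argument \<open>- pi\<close> at the apex \<open>t\<close>, which is then a
  root of \<open>(1 - t)\<^sup>n + z t\<^sup>r\<close> for the positive number \<open>z = param n r \<theta> \<phi>\<close>.\<close>
definition admissible :: "nat \<Rightarrow> nat \<Rightarrow> real \<Rightarrow> real \<Rightarrow> bool" where
  "admissible n r \<theta> \<phi> \<longleftrightarrow> 0 < \<theta> \<and> 0 < \<phi> \<and> real r * \<theta> + real n * \<phi> = pi"

lemma admissible_swap: "admissible n r \<theta> \<phi> \<longleftrightarrow> admissible r n \<phi> \<theta>"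
  by (auto simp: admissible_def add.commute)

lemma param_swap: "param r n \<phi> \<theta> = 1 / param n r \<theta> \<phi>"
  by (simp add: param_def add.commute)

lemma admissible_sum_less_pi:
  assumes "admissible n r \<theta> \<phi>" "n > 0" "r > 0" "max r n > 1"
  shows "\<theta> + \<phi> < pi"
proof -
  have pos: "0 < \<theta>" "0 < \<phi>" and eq: "real r * \<theta> + real n * \<phi> = pi"
    using assms(1) by (auto simp: admissible_def)
  have "1 * \<theta> \<le> real r * \<theta>" "1 * \<phi> \<le> real n * \<phi>"
    using assms pos by (intro mult_right_mono; simp)+
  moreover have "1 * \<theta> < real r * \<theta> \<or> 1 * \<phi> < real n * \<phi>"
    using assms(4) pos by (auto simp: max_def split: if_splits)
  ultimately show ?thesis
    using eq by linarith
qed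

lemma admissible_half_sum:
  assumes "admissible n r \<theta> \<phi>" "n \<ge> 2" "r > 0"
  shows "\<theta> + 2 * \<phi> \<le> pi"
proof -
  have pos: "0 < \<theta>" "0 < \<phi>" and eq: "real r * \<theta> + real n * \<phi> = pi"
    using assms(1) by (auto simp: admissible_def)
  have "1 * \<theta> \<le> real r * \<theta>" "2 * \<phi> \<le> real n * \<phi>"
    using assms pos by (intro mult_right_mono; simp)+
  then show ?thesis
    using eq by linarith
qed

lemma sin_le_sin_add:
  assumes "0 \<le> \<theta>" "0 \<le> \<phi>" "\<theta> + 2 * \<phi> \<le> pi" "\<theta> \<le> pi"
  shows "sin \<phi> \<le> sin (\<theta> + \<phi>)"
proof -
  have "sin (\<theta> + \<phi>) - sin \<phi> = 2 * sin ((\<theta> + \<phi> - \<phi>) / 2) * cos ((\<theta> + \<phi> + \<phi>) / 2)"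
    by (rule sin_diff_sin)
  moreover have "sin ((\<theta> + \<phi> - \<phi>) / 2) \<ge> 0"
    using assms by (intro sin_ge_zero) auto
  moreover have "cos ((\<theta> + \<phi> + \<phi>) / 2) \<ge> 0"
    using assms by (intro cos_ge_zero) auto
  ultimately show ?thesis
    by (metis diff_ge_0_iff_ge mult_nonneg_nonneg zero_le_numeral)
qed

lemma one_minus_apex:
  assumes "sin (\<theta> + \<phi>) \<noteq> 0"
  shows "1 - apex \<theta> \<phi> = of_real (sin \<theta> / sin (\<theta> + \<phi>)) * cis (- \<phi>)"
proof -
  have "of_real (sin (\<theta> + \<phi>)) - of_real (sin \<phi>) * cis \<theta> = of_real (sin \<theta>) * cis (- \<phi>)"
    by (simp add: complex_eq_iff sin_add)
  moreover have "complex_of_real (sin (\<theta> + \<phi>)) \<noteq> 0"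
    using assms by simp
  ultimately show ?thesis
    unfolding apex_def by (simp add: divide_simps)
qed

lemma apex_root:
  assumes adm: "admissible n r \<theta> \<phi>" and sum: "\<theta> + \<phi> < pi"
  shows "(1 - apex \<theta> \<phi>) ^ n + of_real (param n r \<theta> \<phi>) * apex \<theta> \<phi> ^ r = 0"
proof -
  define s where "s = sin (\<theta> + \<phi>)"
  have pos: "0 < \<theta>" "0 < \<phi>" and eq: "real r * \<theta> + real n * \<phi> = pi"
    using adm by (auto simp: admissible_def)
  have s: "s > 0"
    unfolding s_def using pos sum by (intro sin_gt_zero) auto
  have sf: "sin \<phi> > 0"
    using pos sum by (intro sin_gt_zero) auto
  have "cis (real r * \<theta>) = cis (pi + (real n * - \<phi>))"
    by (rule arg_cong[where f = cis]) (use eq in simp)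
  also have "\<dots> = - cis (real n * - \<phi>)"
    by (simp only: cis_mult[symmetric]) simp
  finally have c: "cis (- \<phi>) ^ n = - (cis \<theta> ^ r)"
    by (simp add: Complex.DeMoivre)
  have "(1 - apex \<theta> \<phi>) ^ n = of_real ((sin \<theta> / s) ^ n) * cis (- \<phi>) ^ n"
    unfolding s_def of_real_power power_mult_distrib[symmetric]
    using s by (subst one_minus_apex) (auto simp: s_def)
  moreover have "of_real (param n r \<theta> \<phi>) * apex \<theta> \<phi> ^ r = of_real (param n r \<theta> \<phi> * (sin \<phi> / s) ^ r) * cis \<theta> ^ r"
    by (simp only: apex_def s_def power_mult_distrib of_real_mult of_real_power mult.assoc)
  moreover have "param n r \<theta> \<phi> * (sin \<phi> / s) ^ r = (sin \<theta> / s) ^ n"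
    using s sf by (simp add: param_def s_def)
  ultimately show ?thesis
    using c by simp
qed

text \<open>
  As a function of \<open>s = Ln t\<close> in the strip \<open>0 < Im s < pi\<close>, the map \<open>Ln (1 - exp s)\<close> has the
  derivative \<open>- e / (1 - e)\<close> with \<open>e = exp s\<close>, whose imaginary part is negative. Hence its difference
  quotients, being averages of the derivative over segments in the strip, lie in the lower half-plane.
\<close>
lemma Im_Ln_ratio:
  assumes t: "Im t > 0" and u: "Im u > 0" and ne: "t \<noteq> u"
  shows "Im ((Ln (1 - t) - Ln (1 - u)) * cnj (Ln t - Ln u)) < 0"
proof -
  define v where "v = Ln t - Ln u"
  \<comment> \<open>the segment from \<open>Ln u\<close> to \<open>Ln t\<close>\<close>
  define c where "c x = Ln u + of_real x * v" for x :: real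
  define g where "g x = Im (Ln (1 - exp (c x)) * cnj v)" for x :: real
  have tu: "t \<noteq> 0" "u \<noteq> 0"
    using t u by auto
  have v: "v \<noteq> 0"
    using ne tu by (metis v_def exp_Ln right_minus_eq)
  have strip: "0 < Im (c x) \<and> Im (c x) < pi" if "0 \<le> x" "x \<le> 1" for x
  proof -
    have a: "0 < Im (Ln t)" "Im (Ln t) < pi" "0 < Im (Ln u)" "Im (Ln u) < pi"
      using Im_Ln_pos_lt_imp t u by auto
    have "Im (c x) = (1 - x) * Im (Ln u) + x * Im (Ln t)"
      by (simp add: c_def v_def algebra_simps)
    moreover have "(1 - x) * Im (Ln u) + x * Im (Ln t) > 0"
      using a that by (cases "x = 0") (auto intro: add_nonneg_pos)
    moreover have "(1 - x) * Im (Ln u) + x * Im (Ln t) < pi"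
      using convex_bound_lt[of "Im (Ln u)" pi "Im (Ln t)" "1 - x" x] a that by simp
    ultimately show ?thesis by simp
  qed
  have Im_exp: "Im (exp (c x)) > 0" if "0 \<le> x" "x \<le> 1" for x
    using strip[OF that] by (simp add: Im_exp sin_gt_zero)
  have "g 1 < g 0"
  proof (rule DERIV_neg_imp_decreasing[of 0 1 g])
    fix x :: real assume x: "0 \<le> x" "x \<le> 1"
    define e where "e = exp (c x)"
    have e: "Im e > 0"
      using Im_exp[OF x] by (simp add: e_def)
    have ne1: "1 - e \<noteq> 0"
      using e by auto
    have nonpos: "1 - exp (c x) \<notin> \<real>\<^sub>\<le>\<^sub>0"
      using e by (auto simp: e_def complex_nonpos_Reals_iff)
    have "((\<lambda>y. Ln (1 - exp (Ln u + y * v))) has_field_derivative - (v * e) / (1 - e)) (at (of_real x))"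
      using nonpos unfolding e_def c_def
      by (auto intro!: derivative_eq_intros simp: field_simps)
    then have "((\<lambda>y. Ln (1 - exp (c y))) has_vector_derivative - (v * e) / (1 - e)) (at x)"
      unfolding c_def by (rule has_vector_derivative_real_field)
    then have "((\<lambda>y. Ln (1 - exp (c y)) * cnj v) has_vector_derivative - (v * e) / (1 - e) * cnj v) (at x)"
      by (intro has_vector_derivative_mult_left)
    then have "(g has_vector_derivative Im (- (v * e) / (1 - e) * cnj v)) (at x)"
      unfolding g_def by (rule bounded_linear.has_vector_derivative[OF bounded_linear_Im])
    then have der: "(g has_real_derivative Im (- (v * e) / (1 - e) * cnj v)) (at x)"
      by (simp add: has_real_derivative_iff_has_vector_derivative)
    have "- (v * e) / (1 - e) * cnj v = - ((v * cnj v) * (e / (1 - e)))"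
      by simp
    also have "\<dots> = - (of_real (cmod v ^ 2) * (e / (1 - e)))"
      by (simp only: complex_norm_square)
    finally have eq: "- (v * e) / (1 - e) * cnj v = - (of_real (cmod v ^ 2) * (e / (1 - e)))" .
    have Im_scale: "Im (- (of_real a * y)) = - (a * Im y)" for a y
      by simp
    have "Im (- (v * e) / (1 - e) * cnj v) = - (cmod v ^ 2 * Im (e / (1 - e)))"
      unfolding eq by (rule Im_scale)
    moreover have "Im (e / (1 - e)) > 0"
    proof -
      have "e / (1 - e) = 1 / (1 - e) - 1"
        using ne1 by (simp add: field_simps)
      moreover have "Im (1 / (1 - e)) > 0"
      proof -
        have "Im (1 / (1 - e)) = Im e / ((1 - Re e) ^ 2 + (Im e) ^ 2)"
          by (simp add: Im_divide)
        moreover have "(1 - Re e) ^ 2 + (Im e) ^ 2 > 0"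
          using e by (intro add_nonneg_pos) auto
        ultimately show ?thesis
          using e by simp
      qed
      ultimately show ?thesis by simp
    qed
    ultimately have "Im (- (v * e) / (1 - e) * cnj v) < 0"
      using v by simp
    with der show "\<exists>y. (g has_real_derivative y) (at x) \<and> y < 0"
      by blast
  qed simp
  moreover have "g 1 = Im (Ln (1 - t) * cnj v)" "g 0 = Im (Ln (1 - u) * cnj v)"
    using tu by (simp_all add: g_def c_def v_def)
  ultimately show ?thesis
    by (simp add: v_def algebra_simps)
qed

lemma apex_polar:
  assumes "0 < \<theta>" "0 < \<phi>" "\<theta> + \<phi> < pi"
  shows "cmod (apex \<theta> \<phi>) = sin \<phi> / sin (\<theta> + \<phi>)"
    and "Im (Ln (apex \<theta> \<phi>)) = \<theta>" and "Im (Ln (1 - apex \<theta> \<phi>)) = - \<phi>"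
    and "Im (apex \<theta> \<phi>) > 0"
proof -
  have s: "sin (\<theta> + \<phi>) > 0" "sin \<theta> > 0" "sin \<phi> > 0"
    using assms by (auto intro!: sin_gt_zero)
  show "cmod (apex \<theta> \<phi>) = sin \<phi> / sin (\<theta> + \<phi>)"
    unfolding apex_def norm_mult norm_of_real using s by simp
  have om: "1 - apex \<theta> \<phi> = of_real (sin \<theta> / sin (\<theta> + \<phi>)) * cis (- \<phi>)"
    using s by (intro one_minus_apex) auto
  have arg: "Im (Ln (of_real a * cis x)) = x" if "a > 0" "- pi < x" "x \<le> pi" for a x
  proof -
    have "Ln (exp (Complex (ln a) x)) = Complex (ln a) x"
      using that by (intro Ln_exp) auto
    moreover have "exp (Complex (ln a) x) = of_real a * cis x"
      using that by (simp add: exp_eq_polar exp_ln)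
    ultimately show ?thesis by simp
  qed
  show "Im (Ln (apex \<theta> \<phi>)) = \<theta>"
    unfolding apex_def using assms s by (intro arg) auto
  show "Im (Ln (1 - apex \<theta> \<phi>)) = - \<phi>"
    unfolding om using assms s by (intro arg) auto
  show "Im (apex \<theta> \<phi>) > 0"
    using s by (simp add: apex_def)
qed

text \<open>The convex function \<open>(1 + s)\<^sup>k\<close> lies above its tangent through the origin, which touches at \<open>s = 1 / (k - 1)\<close>.\<close>
lemma bernoulli_power:
  fixes s :: real
  assumes k: "k \<ge> 2" and s: "s \<ge> -1"
  shows "real k ^ k / real (k - 1) ^ (k - 1) * s \<le> (1 + s) ^ k"
proof -
  define Q where "Q = real k / real (k - 1)"
  define y where "y = (1 + s) / Q - 1"
  have Q: "Q > 0"
    using k by (simp add: Q_def)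
  have "1 + real k * y = real (k - 1) * s"
    using k by (simp add: y_def Q_def of_nat_diff field_simps)
  moreover have "1 + real k * y \<le> (1 + y) ^ k"
    using Q s by (intro Bernoulli_inequality) (simp add: y_def)
  ultimately have "Q ^ k * (real (k - 1) * s) \<le> Q ^ k * (1 + y) ^ k"
    using Q by simp
  also have "\<dots> = (1 + s) ^ k"
    using Q by (simp add: y_def power_divide)
  also have "Q ^ k * (real (k - 1) * s) = real k ^ k / real (k - 1) ^ (k - 1) * s"
    using k power_Suc[of "real (k - 1)" "k - 1"] by (simp add: Q_def power_divide)
  finally show ?thesis .
qed

text \<open>
  For roots \<open>t\<close> and \<open>u\<close> in the upper half-plane, \<open>u\<close> being the apex, the equation gives
  \<open>n V = r U + 2 k pi i\<close> with \<open>U = Ln t - Ln u\<close> and \<open>V = Ln (1 - t) - Ln (1 - u)\<close>. The apex has the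
  least possible value of \<open>r arg t - n arg (1 - t)\<close>, namely \<open>pi\<close>, so \<open>k \<le> 0\<close>. If also \<open>Re U \<le> 0\<close>, then
  \<open>n Im (V cnj U) = 2 k pi Re U\<close> is nonnegative, which contradicts \<open>Im_Ln_ratio\<close>
  unless \<open>t = u\<close>.
\<close>
lemma upper_root_dominant:
  assumes adm: "admissible n r \<theta> \<phi>" and n: "n > 0" and r: "r > 0" and sum: "\<theta> + \<phi> < pi"
    and root: "(1 - t) ^ n + of_real (param n r \<theta> \<phi>) * t ^ r = 0"
    and le: "cmod t \<le> cmod (apex \<theta> \<phi>)" and t: "Im t > 0"
  shows "t = apex \<theta> \<phi>"
proof (rule ccontr)
  assume ne: "t \<noteq> apex \<theta> \<phi>"
  define u where "u = apex \<theta> \<phi>"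
  define U where "U = Ln t - Ln u"
  define V where "V = Ln (1 - t) - Ln (1 - u)"
  have pos: "0 < \<theta>" "0 < \<phi>" and eq: "real r * \<theta> + real n * \<phi> = pi"
    using adm by (auto simp: admissible_def)
  note polar = apex_polar[OF pos sum, folded u_def]
  have nz: "t \<noteq> 0" "u \<noteq> 0" "1 - t \<noteq> 0" "1 - u \<noteq> 0"
    using t polar(4) by auto
  have "(1 - t) ^ n * u ^ r = t ^ r * (1 - u) ^ n"
    using root apex_root[OF adm sum] by (simp add: u_def add_eq_0_iff2)
  then have "(1 - t) ^ n / (1 - u) ^ n = t ^ r / u ^ r"
    using nz by (subst frac_eq_eq) auto
  moreover have "exp (of_nat n * V) = (1 - t) ^ n / (1 - u) ^ n"
    using nz by (simp add: V_def exp_of_nat_mult exp_diff power_divide)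
  moreover have "exp (of_nat r * U) = t ^ r / u ^ r"
    using nz by (simp add: U_def exp_of_nat_mult exp_diff power_divide)
  ultimately have "exp (of_nat n * V) = exp (of_nat r * U)"
    by (simp only:)
  then obtain k :: int where k: "of_nat n * V = of_nat r * U + of_int (2 * k) * of_real pi * \<i>"
    unfolding exp_eq by auto
  have "real n * Im V = real r * Im U + of_int (2 * k) * pi"
    using arg_cong[OF k, of Im] by simp
  then have "real n * Im (Ln (1 - t)) - real r * Im (Ln t) = (2 * of_int k - 1) * pi"
    using eq polar by (simp add: U_def V_def algebra_simps)
  moreover have "Im (Ln (1 - t)) < 0"
    using Im_Ln_pos_le[of "1 - t"] nz t Im_Ln_le_pi[of "1 - t"]
    by (smt (verit) minus_complex.simps(2) one_complex.simps(2))
  moreover have "Im (Ln t) > 0"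
    using Im_Ln_pos_lt_imp[OF t] by simp
  ultimately have "(2 * of_int k - 1) * pi < 0"
    using n r by (smt (verit) mult_pos_neg mult_pos_pos of_nat_0_less_iff)
  then have "real_of_int (2 * k) < 1"
    by (simp add: mult_less_0_iff)
  then have k0: "k \<le> 0"
    by linarith
  have "of_nat n * (V * cnj U) = of_nat r * (U * cnj U) + of_int (2 * k) * of_real pi * \<i> * cnj U"
    by (simp only: mult.assoc[symmetric] k distrib_right)
  then have "Im (of_nat n * (V * cnj U)) = Im (of_nat r * (U * cnj U) + of_int (2 * k) * of_real pi * \<i> * cnj U)"
    by (rule arg_cong)
  moreover have "Im (of_nat r * (U * cnj U)) = 0"
    by (simp add: complex_mult_cnj)
  ultimately have "real n * Im (V * cnj U) = of_int (2 * k) * pi * Re U"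
    by simp
  moreover have "Re U \<le> 0"
    using nz le by (simp add: U_def u_def)
  ultimately have "real n * Im (V * cnj U) \<ge> 0"
    using k0 by (simp add: mult_nonpos_nonpos mult_nonpos_nonneg)
  moreover have "Im (V * cnj U) < 0"
    using Im_Ln_ratio[OF t polar(4)] ne by (simp add: U_def V_def u_def)
  ultimately show False
    using n by (simp add: zero_le_mult_iff)
qed

text \<open>
  A real root \<open>x\<close> with \<open>\<bar>x\<bar>\<close> at most the modulus of the apex is also at most as far from 1 as the apex.
  For \<open>n \<ge> 2\<close> the apex has modulus at most 1, which excludes \<open>x > 1\<close>; for \<open>r \<ge> 2\<close> its distance from 1 is
  at most 1, which excludes \<open>x < 0\<close>. In the remaining cases \<open>n = 1\<close> and \<open>r = 1\<close> the bounds on the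
  parameter exclude such roots altogether.
\<close>
lemma no_real_root:
  assumes adm: "admissible n r \<theta> \<phi>" and nr: "n > 0" "r > 0" "max r n > 1"
    and r1: "r = 1 \<Longrightarrow> param n r \<theta> \<phi> < real n ^ n / real (n - 1) ^ (n - 1)"
    and n1: "n = 1 \<Longrightarrow> param n r \<theta> \<phi> > real (r - 1) ^ (r - 1) / real r ^ r"
    and root: "(1 - x) ^ n + param n r \<theta> \<phi> * x ^ r = 0"
    and le: "\<bar>x\<bar> \<le> cmod (apex \<theta> \<phi>)"
  shows False
proof -
  define z where "z = param n r \<theta> \<phi>"
  define s where "s = sin (\<theta> + \<phi>)"
  have pos: "0 < \<theta>" "0 < \<phi>"
    using adm by (auto simp: admissible_def)
  have sum: "\<theta> + \<phi> < pi"
    using admissible_sum_less_pi[OF adm nr] .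
  note polar = apex_polar[OF pos sum]
  have s: "s > 0" "sin \<theta> > 0" "sin \<phi> > 0"
    unfolding s_def using pos sum by (auto intro!: sin_gt_zero)
  have z: "z > 0"
    using s by (simp add: z_def param_def s_def)
  have "\<bar>1 - x\<bar> ^ n = z * \<bar>x\<bar> ^ r"
  proof -
    have "(1 - x) ^ n = - (z * x ^ r)"
      using root by (simp add: z_def)
    then have "\<bar>(1 - x) ^ n\<bar> = \<bar>z * x ^ r\<bar>"
      by simp
    then show ?thesis
      using z by (simp add: abs_mult power_abs)
  qed
  also have "\<dots> \<le> z * (sin \<phi> / s) ^ r"
    using le z polar(1) by (intro mult_left_mono power_mono) (auto simp: s_def)
  also have "\<dots> = (sin \<theta> / s) ^ n"
    using s by (simp add: z_def param_def s_def)
  finally have dist: "\<bar>1 - x\<bar> \<le> sin \<theta> / s"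
    using nr(1) s by (simp add: power_mono_iff)
  consider "x = 0" | "0 < x" "x \<le> 1" | "x > 1" | "x < 0"
    by linarith
  then show False
  proof cases
    case 1
    then show ?thesis
      using root nr by (simp add: power_0_left)
  next
    case 2
    then have "0 \<le> (1 - x) ^ n" "0 < z * x ^ r"
      using z by auto
    then show ?thesis
      using root by (simp add: z_def)
  next
    case 3
    show ?thesis
    proof (cases "n = 1")
      case True
      then have r: "r \<ge> 2"
        using nr by auto
      have "x - 1 = z * x ^ r"
        using root True by (simp add: z_def)
      moreover have "real r ^ r / real (r - 1) ^ (r - 1) * (x - 1) \<le> x ^ r"
        using bernoulli_power[OF r, of "x - 1"] 3 by simp
      ultimately have "(real r ^ r / real (r - 1) ^ (r - 1) * z) * x ^ r \<le> 1 * x ^ r"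
        by (simp add: mult.assoc)
      then have "real r ^ r / real (r - 1) ^ (r - 1) * z \<le> 1"
        using 3 by (subst (asm) mult_le_cancel_right) simp
      then have "z \<le> real (r - 1) ^ (r - 1) / real r ^ r"
        using r by (simp add: field_simps)
      then show ?thesis
        using n1[OF True] by (simp add: z_def)
    next
      case False
      then have "\<theta> + 2 * \<phi> \<le> pi"
        using admissible_half_sum[OF adm] nr by simp
      then have "sin \<phi> \<le> s"
        unfolding s_def using pos by (intro sin_le_sin_add) auto
      then have "sin \<phi> / s \<le> 1"
        using s by simp
      then show ?thesis
        using 3 le polar(1) unfolding s_def by linarith
    qed
  next
    case 4
    show ?thesis
    proof (cases "r = 1")
      case True
      then have n: "n \<ge> 2"
        using nr by auto
      have "(1 - x) ^ n = z * (- x)"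
        using root True by (simp add: z_def)
      moreover have "real n ^ n / real (n - 1) ^ (n - 1) * (- x) \<le> (1 - x) ^ n"
        using bernoulli_power[OF n, of "- x"] 4 by simp
      ultimately have "real n ^ n / real (n - 1) ^ (n - 1) * (- x) \<le> z * (- x)"
        by simp
      then have "real n ^ n / real (n - 1) ^ (n - 1) \<le> z"
        using 4 by (subst (asm) mult_le_cancel_right) simp
      then show ?thesis
        using r1[OF True] by (simp add: z_def)
    next
      case False
      then have "\<phi> + 2 * \<theta> \<le> pi"
        using admissible_half_sum[of r n \<phi> \<theta>] adm nr by (simp add: admissible_swap)
      then have "sin \<theta> \<le> s"
        unfolding s_def using pos sin_le_sin_add[of \<phi> \<theta>] by (simp add: add.commute)
      then have "sin \<theta> / s \<le> 1"
        using s by simp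
      then show ?thesis
        using 4 dist by linarith
    qed
  qed
qed

lemma apex_dominant:
  assumes adm: "admissible n r \<theta> \<phi>" and nr: "n > 0" "r > 0" "max r n > 1"
    and r1: "r = 1 \<Longrightarrow> param n r \<theta> \<phi> < real n ^ n / real (n - 1) ^ (n - 1)"
    and n1: "n = 1 \<Longrightarrow> param n r \<theta> \<phi> > real (r - 1) ^ (r - 1) / real r ^ r"
    and root: "(1 - t) ^ n + of_real (param n r \<theta> \<phi>) * t ^ r = 0"
    and le: "cmod t \<le> cmod (apex \<theta> \<phi>)"
  shows "t = apex \<theta> \<phi> \<or> t = cnj (apex \<theta> \<phi>)"
proof -
  have sum: "\<theta> + \<phi> < pi"
    using admissible_sum_less_pi[OF adm nr] .
  consider "Im t > 0" | "Im t < 0" | "Im t = 0"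
    by linarith
  then show ?thesis
  proof cases
    case 1
    then show ?thesis
      using upper_root_dominant[OF adm nr(1,2) sum root le] by simp
  next
    case 2
    have "cnj ((1 - t) ^ n + of_real (param n r \<theta> \<phi>) * t ^ r) = 0"
      using root by simp
    then have "(1 - cnj t) ^ n + of_real (param n r \<theta> \<phi>) * cnj t ^ r = 0"
      by simp
    then have "cnj t = apex \<theta> \<phi>"
      using upper_root_dominant[OF adm nr(1,2) sum, of "cnj t"] 2 le by simp
    then show ?thesis
      by (metis complex_cnj_cnj)
  next
    case 3
    then have t: "t = of_real (Re t)"
      by (simp add: complex_eq_iff)
    have "complex_of_real ((1 - Re t) ^ n + param n r \<theta> \<phi> * Re t ^ r) = 0"
      using root by (subst (asm) (1 2) t) simp
    then have "(1 - Re t) ^ n + param n r \<theta> \<phi> * Re t ^ r = 0"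
      by (simp only: of_real_eq_0_iff)
    moreover have "\<bar>Re t\<bar> \<le> cmod (apex \<theta> \<phi>)"
      using le abs_Re_le_cmod order_trans by blast
    ultimately show ?thesis
      using no_real_root[OF adm nr r1 n1] by blast
  qed
qed

section \<open>Every point of the interval comes from a triangle\<close>

lemma sin_ratio_limit:
  fixes a b :: real
  assumes "a > 0" "b > 0"
  shows "((\<lambda>x. sin (a * x) / sin (b * x)) \<longlongrightarrow> a / b) (at_right 0)"
  unfolding divide_inverse[of a b] using assms by real_asymp

text \<open>
  As \<open>\<theta>\<close> tends to 0 along the admissible pairs, the parameter tends to the left endpoint of the
  interval. The right endpoint is approached by exchanging \<open>n\<close> and \<open>r\<close>, which inverts the parameter.
\<close>
lemma param_tendsto_left:
  assumes n: "n > 0" and r: "r > 0" and nr: "max r n > 1"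
  shows "((\<lambda>\<theta>. param n r \<theta> ((pi - real r * \<theta>) / real n)) \<longlongrightarrow>
    (if n = 1 then real (r - 1) ^ (r - 1) / real r ^ r else 0)) (at_right 0)"
proof (cases "n = 1")
  case True
  then have r2: "r \<ge> 2"
    using nr by auto
  have "param n r \<theta> ((pi - real r * \<theta>) / real n) =
      (sin (1 * \<theta>) / sin (real (r - 1) * \<theta>)) / (sin (real r * \<theta>) / sin (real (r - 1) * \<theta>)) ^ r" for \<theta>
  proof -
    have "sin (\<theta> + (pi - real r * \<theta>)) = sin (real (r - 1) * \<theta>)"
      using sin_pi_minus[of "real (r - 1) * \<theta>"] r2 by (simp add: of_nat_diff algebra_simps)
    then show ?thesis
      using True by (simp add: param_def)
  qed
  moreover have "((\<lambda>\<theta>. (sin (1 * \<theta>) / sin (real (r - 1) * \<theta>)) / (sin (real r * \<theta>) / sin (real (r - 1) * \<theta>)) ^ r)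
      \<longlongrightarrow> (1 / real (r - 1)) / (real r / real (r - 1)) ^ r) (at_right 0)"
    using r2 by (intro tendsto_divide tendsto_power sin_ratio_limit) auto
  moreover have "(1 / real (r - 1)) / (real r / real (r - 1)) ^ r = real (r - 1) ^ (r - 1) / real r ^ r"
    using r2 power_Suc[of "real (r - 1)" "r - 1"] by (simp add: power_divide)
  ultimately show ?thesis
    using True by simp
next
  case False
  then have n2: "n \<ge> 2"
    using n by simp
  have s: "sin (pi / real n) \<noteq> 0"
    using n2 sin_gt_zero[of "pi / real n"] by (simp add: field_simps)
  have "((\<lambda>\<theta>. param n r \<theta> ((pi - real r * \<theta>) / real n)) \<longlongrightarrow>
      param n r 0 ((pi - real r * 0) / real n)) (at_right 0)"
    unfolding param_def using n s by (intro tendsto_intros) auto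
  then show ?thesis
    using False n by (simp add: param_def power_0_left)
qed

lemma param_small:
  assumes n: "n > 0" and r: "r > 0" and nr: "max r n > 1"
    and z: "(if n = 1 then real (r - 1) ^ (r - 1) / real r ^ r else 0) < z"
  shows "\<exists>\<theta> \<phi>. admissible n r \<theta> \<phi> \<and> param n r \<theta> \<phi> < z"
proof -
  have "\<forall>\<^sub>F \<theta> in at_right 0. param n r \<theta> ((pi - real r * \<theta>) / real n) < z"
    using order_tendstoD(2)[OF param_tendsto_left[OF n r nr] z] .
  moreover have "\<forall>\<^sub>F \<theta> in at_right 0. \<theta> \<in> {0<..<pi / real r}"
    using r by (intro eventually_at_right_real) simp
  ultimately have "\<forall>\<^sub>F \<theta> in at_right 0. \<theta> \<in> {0<..<pi / real r} \<and>
      param n r \<theta> ((pi - real r * \<theta>) / real n) < z"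
    by eventually_elim simp
  then obtain \<theta> where \<theta>: "\<theta> \<in> {0<..<pi / real r}" "param n r \<theta> ((pi - real r * \<theta>) / real n) < z"
    using eventually_happens'[OF trivial_limit_at_right_real] by blast
  then have "admissible n r \<theta> ((pi - real r * \<theta>) / real n)"
    using n r by (simp add: admissible_def field_simps)
  with \<theta> show ?thesis
    by blast
qed

lemma param_pos:
  assumes "admissible n r \<theta> \<phi>" "n > 0" "r > 0" "max r n > 1"
  shows "param n r \<theta> \<phi> > 0"
proof -
  have "0 < \<theta>" "0 < \<phi>" "\<theta> + \<phi> < pi"
    using assms admissible_sum_less_pi[OF assms] by (auto simp: admissible_def)
  then have "sin \<theta> > 0" "sin \<phi> > 0" "sin (\<theta> + \<phi>) > 0"
    by (auto intro!: sin_gt_zero)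
  then show ?thesis
    by (simp add: param_def)
qed

lemma zero_interval_iff:
  assumes "n > 0" "r > 0" "max r n > 1"
  shows "z \<in> zero_interval n r \<longleftrightarrow> 0 < z \<and> (r = 1 \<longrightarrow> z < real n ^ n / real (n - 1) ^ (n - 1))
    \<and> (n = 1 \<longrightarrow> real (r - 1) ^ (r - 1) / real r ^ r < z)"
proof -
  have "0 < z" if "real (r - 1) ^ (r - 1) / real r ^ r < z"
    using that by (rule le_less_trans[rotated]) simp
  then show ?thesis
    using assms by (auto simp: zero_interval_def max_def split: if_splits)
qed

lemma param_surj:
  assumes n: "n > 0" and r: "r > 0" and nr: "max r n > 1" and z: "z \<in> zero_interval n r"
  shows "\<exists>\<theta> \<phi>. admissible n r \<theta> \<phi> \<and> param n r \<theta> \<phi> = z"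
proof -
  have nr': "max n r > 1"
    using nr by (simp add: max.commute)
  have z0: "z > 0"
    using z zero_interval_iff[OF n r nr] by simp
  define f where "f \<theta> = param n r \<theta> ((pi - real r * \<theta>) / real n)" for \<theta>
  define J where "J = {0<..<pi / real r}"
  have adm: "admissible n r \<theta> ((pi - real r * \<theta>) / real n)" if "\<theta> \<in> J" for \<theta>
    using that n r by (simp add: admissible_def J_def field_simps)
  have adm': "\<theta> \<in> J \<and> f \<theta> = param n r \<theta> \<phi>" if "admissible n r \<theta> \<phi>" for \<theta> \<phi>
  proof -
    have pos: "0 < \<theta>" "0 < \<phi>" and eq: "real r * \<theta> + real n * \<phi> = pi"
      using that by (auto simp: admissible_def)
    have "\<phi> = (pi - real r * \<theta>) / real n"
      using eq n by (simp add: field_simps)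
    moreover have "real r * \<theta> < pi"
      using eq pos n by (smt (verit) mult_pos_pos of_nat_0_less_iff)
    ultimately show ?thesis
      using pos r by (simp add: f_def J_def field_simps)
  qed
  have "(if n = 1 then real (r - 1) ^ (r - 1) / real r ^ r else 0) < z"
    using z zero_interval_iff[OF n r nr] by auto
  from param_small[OF n r nr this] obtain a where a: "a \<in> J" "f a < z"
    using adm' by metis
  have "(if r = 1 then real (n - 1) ^ (n - 1) / real n ^ n else 0) < 1 / z"
  proof (cases "r = 1")
    case True
    then have "n \<ge> 2" "z < real n ^ n / real (n - 1) ^ (n - 1)"
      using nr z zero_interval_iff[OF n r nr] by auto
    then show ?thesis
      using True z0 by (simp add: field_simps)
  qed (use z0 in simp)
  from param_small[OF r n nr' this] obtain \<phi> b where b: "admissible n r b \<phi>" "1 / param n r b \<phi> < 1 / z"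
    using admissible_swap param_swap by metis
  moreover have "param n r b \<phi> > 0"
    using param_pos[OF b(1) n r nr] .
  ultimately have b': "b \<in> J" "z < f b"
    using adm'[OF b(1)] z0 by (auto simp: field_simps)
  have "continuous_on J f"
  proof -
    have "sin (\<theta> + (pi - real r * \<theta>) / real n) \<noteq> 0 \<and> sin ((pi - real r * \<theta>) / real n) \<noteq> 0" if "\<theta> \<in> J" for \<theta>
    proof -
      define \<phi> where "\<phi> = (pi - real r * \<theta>) / real n"
      have "0 < \<theta>" "0 < \<phi>" "\<theta> + \<phi> < pi"
        using adm[OF that] admissible_sum_less_pi[OF adm[OF that] n r nr]
        by (auto simp: admissible_def \<phi>_def)
      then have "sin (\<theta> + \<phi>) > 0" "sin \<phi> > 0"
        by (auto intro!: sin_gt_zero)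
      then show ?thesis
        by (simp add: \<phi>_def)
    qed
    then show ?thesis
      unfolding f_def param_def using n by (intro continuous_intros) auto
  qed
  then have "connected (f ` J)"
    unfolding J_def by (intro connected_continuous_image) auto
  then have "z \<in> f ` J"
    using a b' by (intro connectedD_interval[of "f ` J" "f a" "f b" z]) auto
  then obtain \<theta> where "\<theta> \<in> J" "f \<theta> = z"
    by auto
  then show ?thesis
    using adm[of \<theta>] unfolding f_def by blast
qed

section \<open>Coefficient asymptotics with two dominant poles\<close>

text \<open>
  \<open>B\<close> has finitely many zeros, all outside the closed disc, so \<open>1 / B\<close> is holomorphic on a larger disc.
\<close>
lemma inverse_poly_sums:
  fixes B :: "complex poly" and G :: "complex fps"
  assumes G: "G * fps_of_poly B = 1" and nz: "\<And>t. cmod t \<le> \<tau> \<Longrightarrow> poly B t \<noteq> 0"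
    and t: "cmod t \<le> \<tau>"
  shows "(\<lambda>k. fps_nth G k * t ^ k) sums (1 / poly B t)"
proof -
  define S where "S = insert (\<tau> + 1) (cmod ` {x. poly B x = 0})"
  define \<rho> where "\<rho> = Min S"
  have "B \<noteq> 0"
    using nz[OF t] by auto
  then have fin: "finite S"
    by (simp add: S_def poly_roots_finite)
  have "\<rho> \<in> S"
    unfolding \<rho>_def using fin by (intro Min_in) (auto simp: S_def)
  then have gt: "\<rho> > \<tau>"
    using nz by (force simp: S_def)
  have nz': "poly B x \<noteq> 0" if "cmod x < \<rho>" for x
  proof
    assume "poly B x = 0"
    then have "\<rho> \<le> cmod x"
      unfolding \<rho>_def using fin by (intro Min_le) (auto simp: S_def)
    with that show False by simp
  qed
  have "0 \<le> \<tau>"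
    using t norm_ge_zero order_trans by blast
  then have B0: "fps_nth (fps_of_poly B) 0 \<noteq> 0"
    using nz[of 0] by (simp add: poly_0_coeff_0)
  have "G = inverse (fps_of_poly B)"
    using G by (metis fps_inverse_unique mult.commute)
  moreover have "(\<lambda>x. poly B x) has_fps_expansion fps_of_poly B"
    using eval_fps_has_fps_expansion[of "fps_of_poly B"] eval_fps_of_poly[of B, abs_def] by simp
  ultimately have "(\<lambda>x. inverse (poly B x)) has_fps_expansion G"
    using has_fps_expansion_inverse B0 by blast
  moreover have "(\<lambda>x. inverse (poly B x)) holomorphic_on eball 0 (ereal \<rho>)"
    using nz' by (auto intro!: holomorphic_intros)
  ultimately have "(\<lambda>k. fps_nth G k * t ^ k) sums inverse (poly B t)"
    using gt t by (intro has_fps_expansion_imp_sums_complex[where r = "ereal \<rho>"]) auto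
  then show ?thesis
    by (simp add: inverse_eq_divide)
qed

lemma fps_mult_geometric_nth:
  fixes u t :: "'a::field"
  assumes "u * t = 1"
  shows "fps_nth (G * Abs_fps (\<lambda>m. u ^ Suc m)) m = u ^ Suc m * (\<Sum>k\<le>m. fps_nth G k * t ^ k)"
proof -
  have *: "fps_nth G k * u ^ Suc (m - k) = u ^ Suc m * (fps_nth G k * t ^ k)" if "k \<le> m" for k
  proof -
    have "u ^ Suc m = u ^ Suc (m - k) * u ^ k"
      using that by (simp flip: power_add power_Suc)
    then have "u ^ Suc m * t ^ k = u ^ Suc (m - k) * (u * t) ^ k"
      by (simp only: power_mult_distrib mult.assoc)
    then have "u ^ Suc (m - k) = u ^ Suc m * t ^ k"
      by (simp only: assms power_one mult_1_right)
    then show ?thesis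
      by (simp only: ac_simps)
  qed
  have "fps_nth (G * Abs_fps (\<lambda>m. u ^ Suc m)) m = (\<Sum>k\<le>m. fps_nth G k * u ^ Suc (m - k))"
    by (simp add: fps_mult_nth atLeast0AtMost del: power_Suc)
  also have "\<dots> = (\<Sum>k\<le>m. u ^ Suc m * (fps_nth G k * t ^ k))"
    using * by (intro sum.cong) auto
  finally show ?thesis
    by (simp only: sum_distrib_left)
qed

lemma simple_root_cofactor:
  fixes D :: "'a::field poly"
  assumes "D = [:- a, 1:] * B" "poly (pderiv D) a \<noteq> 0"
  shows "poly B a \<noteq> 0"
proof -
  have "poly (pderiv D) a = poly B a"
    unfolding assms(1) pderiv_mult poly_add poly_mult by (simp add: pderiv_pCons)
  then show ?thesis
    using assms(2) by simp
qed

text \<open>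
  With \<open>G = F (a - t) (b - t)\<close>, which converges at \<open>a\<close> and \<open>b\<close>, partial fractions give
  \<open>(b - a) F = G / (a - t) - G / (b - t)\<close>. The \<open>m\<close>-th coefficient of \<open>G / (a - t)\<close> is \<open>a\<^bsup>-m-1\<^esup>\<close> times a
  partial sum of the series \<open>G(a)\<close>, and \<open>G(a)\<close> is not zero.
\<close>
lemma two_dominant_roots_asymptotics:
  fixes D :: "complex poly" and F :: "complex fps"
  assumes F: "F * fps_of_poly D = 1"
    and roots: "poly D a = 0" "poly D b = 0" "a \<noteq> b"
    and simple: "poly (pderiv D) a \<noteq> 0" "poly (pderiv D) b \<noteq> 0"
    and norm: "cmod a = \<tau>" "cmod b = \<tau>"
    and dom: "\<And>t. poly D t = 0 \<Longrightarrow> cmod t \<le> \<tau> \<Longrightarrow> t = a \<or> t = b"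
  shows "\<exists>c d. c \<noteq> 0 \<and> d \<noteq> 0 \<and>
    (\<lambda>m. fps_nth F m * of_real \<tau> ^ m - (c * (of_real \<tau> / a) ^ m + d * (of_real \<tau> / b) ^ m)) \<longlonglongrightarrow> 0"
proof -
  have "poly D 0 \<noteq> 0"
  proof -
    have "fps_nth F 0 * coeff D 0 = 1"
      using arg_cong[OF F, of "\<lambda>f. fps_nth f 0"] by simp
    then show ?thesis
      by (auto simp: poly_0_coeff_0)
  qed
  then have nz: "a \<noteq> 0" "b \<noteq> 0"
    using roots by auto
  then have \<tau>: "\<tau> > 0"
    using norm by auto
  obtain D1 where D1: "D = [:- a, 1:] * D1"
    using roots(1) by (auto simp: poly_eq_0_iff_dvd dvd_def)
  moreover have "poly D1 b = 0"
    using roots D1 by auto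
  then obtain B where B: "D1 = [:- b, 1:] * B"
    by (auto simp: poly_eq_0_iff_dvd dvd_def)
  ultimately have D: "D = [:- a, 1:] * ([:- b, 1:] * B)" "D = [:- b, 1:] * ([:- a, 1:] * B)"
    by (simp_all only: mult.left_commute)
  have "poly ([:- b, 1:] * B) a \<noteq> 0" "poly ([:- a, 1:] * B) b \<noteq> 0"
    using simple_root_cofactor D simple by blast+
  then have Bab: "poly B a \<noteq> 0" "poly B b \<noteq> 0"
    by auto
  have Bnz: "poly B t \<noteq> 0" if "cmod t \<le> \<tau>" for t
    using dom[of t] that Bab D by auto
  define L where "L x = fps_const x - fps_X" for x :: complex
  define G where "G = F * L a * L b"
  have L: "fps_of_poly [:- x, 1:] = - L x" for x
    by (simp add: L_def fps_of_poly_linear)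
  have "fps_of_poly D = L a * (L b * fps_of_poly B)"
    by (subst D(1)) (simp only: fps_of_poly_mult L, simp)
  then have G: "G * fps_of_poly B = 1"
    using F by (simp add: G_def mult.assoc)
  define H where "H x = Abs_fps (\<lambda>m. inverse x ^ Suc m)" for x :: complex
  have HL: "L x * H x = 1" if "x \<noteq> 0" for x
  proof (rule fps_ext)
    fix m
    show "fps_nth (L x * H x) m = fps_nth 1 m"
      using that by (cases m) (simp_all add: L_def H_def left_diff_distrib)
  qed
  have "F * L b = G * H a"
    using HL[OF nz(1)] by (simp add: G_def ac_simps)
  moreover have "F * L a = G * H b"
    using HL[OF nz(2)] by (simp add: G_def mult.assoc)
  moreover have "F * L b - F * L a = fps_const (b - a) * F"
    by (simp add: L_def algebra_simps flip: fps_const_sub)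
  ultimately have FG: "fps_const (b - a) * F = G * H a - G * H b"
    by simp
  define S where "S x m = (\<Sum>k\<le>m. fps_nth G k * x ^ k)" for x m
  have GH: "fps_nth (G * H x) m = inverse x ^ Suc m * S x m" if "x \<noteq> 0" for x m
    unfolding H_def S_def using that by (intro fps_mult_geometric_nth) simp
  have S: "S x \<longlonglongrightarrow> 1 / poly B x" if "cmod x = \<tau>" for x
    using inverse_poly_sums[OF G Bnz, of \<tau> x] that unfolding sums_def_le S_def by simp
  define E where "E x m = (of_real \<tau> / x) ^ m * (S x m - 1 / poly B x)" for x m
  have E: "E x \<longlonglongrightarrow> 0" if "cmod x = \<tau>" for x
  proof -
    have "(\<lambda>m. S x m - 1 / poly B x) \<longlonglongrightarrow> 0"
      using S[OF that] by (simp add: LIM_zero_iff)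
    moreover have "cmod (of_real \<tau> / x) = 1"
      using that \<tau> by (simp add: norm_divide)
    ultimately show ?thesis
      unfolding E_def
      by (subst tendsto_norm_zero_iff[symmetric])
         (simp add: norm_mult norm_power tendsto_norm_zero)
  qed
  define c where "c = 1 / (a * (b - a) * poly B a)"
  define d where "d = - 1 / (b * (b - a) * poly B b)"
  have "fps_nth F m * of_real \<tau> ^ m - (c * (of_real \<tau> / a) ^ m + d * (of_real \<tau> / b) ^ m)
     = (E a m / a - E b m / b) / (b - a)" for m
  proof -
    have "(b - a) * fps_nth F m = inverse a ^ Suc m * S a m - inverse b ^ Suc m * S b m"
      using arg_cong[OF FG, of "\<lambda>f. fps_nth f m"] nz by (simp add: GH)
    then have Fm: "fps_nth F m = (inverse a ^ Suc m * S a m - inverse b ^ Suc m * S b m) / (b - a)"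
      using roots(3) by (simp add: field_simps)
    define e where "e = b - a"
    define x where "x = (of_real \<tau> / a) ^ m"
    define y where "y = (of_real \<tau> / b) ^ m"
    have "inverse a ^ Suc m * of_real \<tau> ^ m = x / a" "inverse b ^ Suc m * of_real \<tau> ^ m = y / b"
      by (simp_all add: x_def y_def field_simps)
    then have "inverse a ^ Suc m * S a m * of_real \<tau> ^ m = x / a * S a m"
      "inverse b ^ Suc m * S b m * of_real \<tau> ^ m = y / b * S b m"
      by (simp_all only: mult.assoc mult.commute mult.left_commute)
    then have "fps_nth F m * of_real \<tau> ^ m = (x / a * S a m - y / b * S b m) / e"
      unfolding Fm e_def[symmetric] times_divide_eq_left left_diff_distrib by simp
    moreover have "c = 1 / poly B a / a / e" "d = - (1 / poly B b / b / e)"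
      by (auto simp: c_def d_def e_def)
    ultimately show ?thesis
      unfolding E_def e_def[symmetric] x_def[symmetric] y_def[symmetric]
      by (simp add: diff_divide_distrib right_diff_distrib ac_simps)
  qed
  moreover have "(\<lambda>m. (E a m / a - E b m / b) / (b - a)) \<longlonglongrightarrow> (0 / a - 0 / b) / (b - a)"
    using E norm nz roots(3) by (intro tendsto_intros) auto
  ultimately have "(\<lambda>m. fps_nth F m * of_real \<tau> ^ m - (c * (of_real \<tau> / a) ^ m + d * (of_real \<tau> / b) ^ m)) \<longlonglongrightarrow> 0"
    by simp
  moreover have "c \<noteq> 0" "d \<noteq> 0"
    using nz Bab roots(3) by (auto simp: c_def d_def)
  ultimately show ?thesis by blast
qed

section \<open>Products of oscillating sequences\<close>

text \<open>Convergence of the averages \<open>(f 0 + \<dots> + f (N - 1)) / N\<close>.\<close>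
definition has_mean :: "(nat \<Rightarrow> 'a::real_normed_field) \<Rightarrow> 'a \<Rightarrow> bool" where
  "has_mean f L \<longleftrightarrow> (\<lambda>N. (\<Sum>m<N. f m) / of_nat N) \<longlonglongrightarrow> L"

lemma has_mean_add: "has_mean f a \<Longrightarrow> has_mean g b \<Longrightarrow> has_mean (\<lambda>m. f m + g m) (a + b)"
  unfolding has_mean_def by (drule (1) tendsto_add) (simp add: sum.distrib add_divide_distrib)

lemma has_mean_cmult: "has_mean f a \<Longrightarrow> has_mean (\<lambda>m. c * f m) (c * a)"
  unfolding has_mean_def by (drule tendsto_mult_left[of _ _ _ c]) (simp add: sum_distrib_left)

lemma has_mean_one: "has_mean (\<lambda>m. 1) 1"
proof -
  have "\<forall>\<^sub>F N in sequentially. (\<Sum>m<N. (1::'a)) / of_nat N = 1"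
    using eventually_gt_at_top[of 0] by eventually_elim simp
  then show ?thesis
    unfolding has_mean_def by (rule tendsto_eventually)
qed

lemma has_mean_null:
  fixes f :: "nat \<Rightarrow> 'a::real_normed_field"
  assumes "f \<longlonglongrightarrow> 0"
  shows "has_mean f 0"
  unfolding has_mean_def
proof (rule LIMSEQ_I)
  fix e :: real assume e: "e > 0"
  obtain M where M: "\<And>m. m \<ge> M \<Longrightarrow> norm (f m) < e / 2"
    using LIMSEQ_D[OF assms, of "e / 2"] e by auto
  define K where "K = (\<Sum>m<M. norm (f m))"
  have K: "K \<ge> 0"
    by (simp add: K_def sum_nonneg)
  obtain N0 :: nat where N0: "2 * K / e < real N0"
    using reals_Archimedean2 by blast
  show "\<exists>no. \<forall>N\<ge>no. norm ((\<Sum>m<N. f m) / of_nat N - 0) < e"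
  proof (intro exI allI impI)
    fix N assume N: "N \<ge> Suc (max M N0)"
    have "(\<Sum>m<N. norm (f m)) = K + (\<Sum>m=M..<N. norm (f m))"
      unfolding K_def lessThan_atLeast0 using N by (simp add: sum.atLeastLessThan_concat)
    moreover have "(\<Sum>m=M..<N. norm (f m)) \<le> (\<Sum>m=M..<N. e / 2)"
      using M by (intro sum_mono less_imp_le) auto
    moreover have "(\<Sum>m=M..<N. e / 2) \<le> real N * (e / 2)"
      using e by (simp add: mult_right_mono)
    moreover have "norm (\<Sum>m<N. f m) \<le> (\<Sum>m<N. norm (f m))"
      by (rule norm_sum)
    moreover have "K < real N * (e / 2)"
    proof -
      have "2 * K / e < real N"
        using N0 N by linarith
      then show ?thesis
        using e by (simp add: field_simps)
    qed
    ultimately have "norm (\<Sum>m<N. f m) < real N * (e / 2) + real N * (e / 2)"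
      by linarith
    then have "norm (\<Sum>m<N. f m) < real N * e"
      by (simp add: field_simps)
    then show "norm ((\<Sum>m<N. f m) / of_nat N - 0) < e"
      using N by (simp add: norm_divide divide_less_eq mult.commute)
  qed
qed

lemma has_mean_power:
  fixes w :: "'a::real_normed_field"
  assumes "norm w = 1"
  shows "has_mean (\<lambda>m. w ^ m) (if w = 1 then 1 else 0)"
proof (cases "w = 1")
  case True
  then show ?thesis
    using has_mean_one by simp
next
  case False
  have "norm ((\<Sum>m<N. w ^ m) / of_nat N) \<le> 2 / norm (1 - w) / real N" for N
  proof -
    have "norm (\<Sum>m<N. w ^ m) = norm (1 - w ^ N) / norm (1 - w)"
      using False by (simp add: sum_gp_strict norm_divide)
    also have "\<dots> \<le> (norm (1::'a) + norm (w ^ N)) / norm (1 - w)"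
      by (intro divide_right_mono norm_triangle_ineq4) auto
    also have "\<dots> = 2 / norm (1 - w)"
      using assms by (simp add: norm_power)
    finally show ?thesis
      unfolding norm_divide norm_of_nat by (intro divide_right_mono) auto
  qed
  moreover have "(\<lambda>N. 2 / norm (1 - w) / real N) \<longlonglongrightarrow> 0"
    by (rule lim_const_over_n)
  ultimately have "has_mean (\<lambda>m. w ^ m) 0"
    unfolding has_mean_def by (rule Lim_null_comparison[OF always_eventually[OF allI]])
  then show ?thesis
    using False by simp
qed

lemma has_mean_norm_le:
  assumes "has_mean f a" "has_mean g (b::real)" "\<And>m. norm (f m) \<le> g m"
  shows "norm a \<le> b"
proof -
  have "norm ((\<Sum>m<N. f m) / of_nat N) \<le> (\<Sum>m<N. g m) / of_nat N" for N
    using assms(3) by (simp add: norm_divide divide_right_mono sum_norm_le)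
  then show ?thesis
    using LIMSEQ_le[OF tendsto_norm[OF assms(1)[unfolded has_mean_def]] assms(2)[unfolded has_mean_def]]
    by blast
qed

lemma has_mean_Re:
  assumes "has_mean f a" shows "has_mean (\<lambda>m. Re (f m)) (Re a)"
proof -
  have "(\<lambda>N. Re ((\<Sum>m<N. f m) / of_nat N)) \<longlonglongrightarrow> Re a"
    using assms unfolding has_mean_def by (rule tendsto_Re)
  then show ?thesis
    unfolding has_mean_def by simp
qed

text \<open>
  Up to a null sequence, \<open>f m * g m\<close> is a combination of the powers of \<open>w v\<close>, \<open>w cnj v\<close>, \<open>cnj w v\<close>
  and \<open>cnj w cnj v\<close>, all different from 1, so its mean is 0. If \<open>f m * g m\<close> were never negative, its
  products with any powers of unimodular numbers would also have mean 0; but multiplication by the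
  powers of \<open>cnj w v\<close> yields the mean \<open>a * b'\<close>, because \<open>w cnj v\<close> differs from the other three
  frequencies.
\<close>
lemma oscillating_products_negative:
  fixes f g :: "nat \<Rightarrow> real" and a b a' b' w v :: complex
  assumes f: "(\<lambda>m. of_real (f m) - (a * w ^ m + a' * cnj w ^ m)) \<longlonglongrightarrow> 0"
    and g: "(\<lambda>m. of_real (g m) - (b * v ^ m + b' * cnj v ^ m)) \<longlonglongrightarrow> 0"
    and nz: "a \<noteq> 0" "b' \<noteq> 0"
    and w: "w = cis \<theta>" "0 < \<theta>" "\<theta> < pi" and v: "v = cis \<psi>" "0 < \<psi>" "\<psi> < pi" and ne: "\<theta> \<noteq> \<psi>"
  shows "\<exists>m. f m * g m < 0"
proof (rule ccontr)
  assume "\<not> ?thesis"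
  then have nonneg: "f m * g m \<ge> 0" for m
    using not_less by blast
  have cis_ne: "cis x \<noteq> 1" if "x \<noteq> 0" "- (2 * pi) < x" "x < 2 * pi" for x
  proof
    assume "cis x = 1"
    then have "cos x = 1"
      by (simp add: complex_eq_iff)
    then have "cos \<bar>x\<bar> = 1"
      by simp
    then obtain k :: int where "\<bar>x\<bar> = of_int k * 2 * pi"
      unfolding cos_one_2pi_int by blast
    then have "\<bar>x\<bar> = of_int k * (2 * pi)"
      by simp
    moreover have "0 < \<bar>x\<bar>" "\<bar>x\<bar> < 2 * pi"
      using that by auto
    ultimately have "0 < real_of_int k * (2 * pi)" "real_of_int k * (2 * pi) < 1 * (2 * pi)"
      by auto
    then have "0 < k" "k < 1"
      by (auto simp: zero_less_mult_iff)
    then show False by simp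
  qed
  have norm: "norm w = 1" "norm v = 1"
    by (simp_all add: w v)
  define F where "F m = a * w ^ m + a' * cnj w ^ m" for m
  define G where "G m = b * v ^ m + b' * cnj v ^ m" for m
  have Fb: "norm (F m) \<le> norm a + norm a'" for m
    unfolding F_def by (rule order_trans[OF norm_triangle_ineq]) (simp add: norm_mult norm_power norm)
  have Gb: "norm (G m) \<le> norm b + norm b'" for m
    unfolding G_def by (rule order_trans[OF norm_triangle_ineq]) (simp add: norm_mult norm_power norm)
  define E where "E m = of_real (f m * g m) - F m * G m" for m
  have "E \<longlonglongrightarrow> 0"
  proof -
    have fF: "(\<lambda>m. of_real (f m) - F m) \<longlonglongrightarrow> 0" and gG: "(\<lambda>m. of_real (g m) - G m) \<longlonglongrightarrow> 0"
      using f g by (simp_all add: F_def G_def)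
    have "(\<lambda>m. (of_real (f m) - F m) * G m) \<longlonglongrightarrow> 0"
      using Gb by (intro lim_null_mult_right_bounded[OF fF] always_eventually) auto
    moreover have "(\<lambda>m. F m * (of_real (g m) - G m)) \<longlonglongrightarrow> 0"
      using Fb by (intro lim_null_mult_left_bounded[OF _ gG] always_eventually) auto
    moreover have "(\<lambda>m. (of_real (f m) - F m) * (of_real (g m) - G m)) \<longlonglongrightarrow> 0"
      using tendsto_mult[OF fF gG] by simp
    ultimately have "(\<lambda>m. (of_real (f m) - F m) * G m + F m * (of_real (g m) - G m)
        + (of_real (f m) - F m) * (of_real (g m) - G m)) \<longlonglongrightarrow> 0 + 0 + 0"
      by (intro tendsto_add)
    then show ?thesis
      unfolding E_def by (simp add: algebra_simps)
  qed
  have mean: "has_mean (\<lambda>m. of_real (f m * g m) * y ^ m) (a * b * (if w * v * y = 1 then 1 else 0)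
      + a * b' * (if w * cnj v * y = 1 then 1 else 0) + a' * b * (if cnj w * v * y = 1 then 1 else 0)
      + a' * b' * (if cnj w * cnj v * y = 1 then 1 else 0) + 0)"
    (is "has_mean _ ?L") if y: "norm y = 1" for y
  proof -
    have "(\<lambda>m. E m * y ^ m) \<longlonglongrightarrow> 0"
      using \<open>E \<longlonglongrightarrow> 0\<close> y by (subst tendsto_norm_zero_iff[symmetric])
        (simp add: norm_mult norm_power tendsto_norm_zero)
    then have "has_mean (\<lambda>m. a * b * (w * v * y) ^ m + a * b' * (w * cnj v * y) ^ m + a' * b * (cnj w * v * y) ^ m
        + a' * b' * (cnj w * cnj v * y) ^ m + E m * y ^ m) ?L"
      using y norm by (intro has_mean_add has_mean_cmult has_mean_power has_mean_null) (auto simp: norm_mult)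
    moreover have "a * b * (w * v * y) ^ m + a * b' * (w * cnj v * y) ^ m + a' * b * (cnj w * v * y) ^ m
        + a' * b' * (cnj w * cnj v * y) ^ m + E m * y ^ m = of_real (f m * g m) * y ^ m" for m
      unfolding E_def F_def G_def power_mult_distrib by (simp add: algebra_simps)
    ultimately show ?thesis by simp
  qed
  have cnj: "cnj w = cis (- \<theta>)" "cnj v = cis (- \<psi>)"
    by (simp_all add: w v cis_cnj)
  have mult: "cis \<theta> * cis \<psi> = cis (\<theta> + \<psi>)" "cis \<theta> * cis (- \<psi>) = cis (\<theta> - \<psi>)"
    "cis (- \<theta>) * cis \<psi> = cis (\<psi> - \<theta>)" "cis (- \<theta>) * cis (- \<psi>) = cis (- \<theta> - \<psi>)"
    "cis (\<theta> - \<psi>) * cis (\<psi> - \<theta>) = 1" "cis (\<theta> + \<psi>) * cis (\<psi> - \<theta>) = cis (2 * \<psi>)"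
    "cis (\<psi> - \<theta>) * cis (\<psi> - \<theta>) = cis (2 * (\<psi> - \<theta>))"
    "cis (- \<theta> - \<psi>) * cis (\<psi> - \<theta>) = cis (- 2 * \<theta>)"
    by (simp_all add: cis_mult)
  have ne1: "cis (\<theta> + \<psi>) \<noteq> 1" "cis (\<theta> - \<psi>) \<noteq> 1" "cis (\<psi> - \<theta>) \<noteq> 1" "cis (- \<theta> - \<psi>) \<noteq> 1"
    "cis (2 * \<psi>) \<noteq> 1"
    by (rule cis_ne; use w v ne in linarith)+
  have ne2: "cis (2 * (\<psi> - \<theta>)) \<noteq> 1"
    using w v ne by (intro cis_ne) auto
  have ne3: "cis (- 2 * \<theta>) \<noteq> 1"
    using w v ne by (intro cis_ne) auto
  have "has_mean (\<lambda>m. complex_of_real (f m * g m)) 0"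
    using mean[of 1] unfolding w(1)[symmetric] v(1)[symmetric] cnj
    unfolding w(1) v(1) mult mult_1_right power_one if_not_P[OF ne1(1)] if_not_P[OF ne1(2)]
      if_not_P[OF ne1(3)] if_not_P[OF ne1(4)] by simp
  then have "has_mean (\<lambda>m. Re (complex_of_real (f m * g m))) (Re 0)"
    by (rule has_mean_Re)
  then have mean0: "has_mean (\<lambda>m. f m * g m) 0"
    by simp
  have "has_mean (\<lambda>m. of_real (f m * g m) * cis (\<psi> - \<theta>) ^ m) (a * b')"
    using mean[of "cis (\<psi> - \<theta>)"] unfolding cnj
    unfolding w(1) v(1) mult if_not_P[OF ne1(5)] if_not_P[OF ne2] if_not_P[OF ne3] by simp
  moreover have "norm (of_real (f m * g m) * cis (\<psi> - \<theta>) ^ m) \<le> f m * g m" for m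
    unfolding norm_mult norm_power norm_cis norm_of_real by (simp add: abs_of_nonneg[OF nonneg] flip: abs_mult)
  ultimately have "norm (a * b') \<le> 0"
    by (rule has_mean_norm_le[OF _ mean0])
  then show False
    using nz by simp
qed

section \<open>Location and density of the zeros\<close>

text \<open>
  A ring homomorphism on the coefficients turns the generating relation over \<open>real poly\<close> into one over
  its target ring.
\<close>
lemma generated_by_evaluate:
  fixes e :: "real poly \<Rightarrow> 'a::comm_ring_1"
  assumes gen: "generated_by n r P"
    and add: "\<And>p q. e (p + q) = e p + e q" and mult: "\<And>p q. e (p * q) = e p * e q" and one: "e 1 = 1"
  shows "Abs_fps (\<lambda>m. e (P m)) * ((1 - fps_X) ^ n + fps_const (e [:0, 1:]) * fps_X ^ r) = 1"
proof -
  define E where "E f = Abs_fps (\<lambda>i. e (fps_nth f i))" for f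
  have e0: "e 0 = 0"
    using add[of 0 0] by simp
  have diff: "e (p - q) = e p - e q" for p q
    using add[of "p - q" q] by simp
  have e_sum: "e (sum h A) = (\<Sum>x\<in>A. e (h x))" for h :: "nat \<Rightarrow> real poly" and A
    by (induction A rule: infinite_finite_induct) (auto simp: e0 add)
  have Emult: "E (f * g) = E f * E g" for f g
    by (rule fps_ext) (simp add: E_def fps_mult_nth e_sum mult)
  have Eone: "E 1 = 1"
    by (rule fps_ext) (simp add: E_def e0 one)
  have Epow: "E (f ^ k) = E f ^ k" for f k
    by (induction k) (simp_all add: Eone Emult)
  have EX: "E fps_X = fps_X"
    by (rule fps_ext) (simp add: E_def e0 one fps_X_def)
  have "E (1 - fps_X) = 1 - fps_X"
    by (rule fps_ext) (simp add: E_def e0 one fps_X_def diff)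
  moreover have "E (fps_const c) = fps_const (e c)" for c
    by (rule fps_ext) (simp add: E_def e0)
  moreover have "E (f + g) = E f + E g" for f g
    by (rule fps_ext) (simp add: E_def add)
  ultimately have "E (gen_denom n r) = (1 - fps_X) ^ n + fps_const (e [:0, 1:]) * fps_X ^ r"
    by (simp add: gen_denom_def Emult Epow EX)
  moreover have "E (Abs_fps P) = Abs_fps (\<lambda>m. e (P m))"
    by (simp add: E_def)
  moreover have "E (Abs_fps P * gen_denom n r) = 1"
    using gen by (simp add: generated_by_def Eone)
  ultimately show ?thesis
    by (simp add: Emult)
qed

lemma map_poly_of_real_add:
  "map_poly complex_of_real (p + q) = map_poly of_real p + map_poly of_real q"
  by (rule poly_eqI) (simp add: coeff_map_poly)

lemma map_poly_of_real_mult: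
  "map_poly complex_of_real (p * q) = map_poly of_real p * map_poly of_real q"
  by (rule poly_eqI) (simp add: coeff_map_poly coeff_mult)

lemma poly_map_poly_of_real:
  "poly (map_poly complex_of_real p) (of_real x) = of_real (poly p x)"
  by (induction p) (simp_all add: map_poly_pCons)

lemma poly_map_poly_of_real_cnj:
  "poly (map_poly complex_of_real p) (cnj z) = cnj (poly (map_poly of_real p) z)"
  by (induction p) (simp_all add: map_poly_pCons)

lemma generated_by_complex:
  assumes "generated_by n r P"
  shows "Abs_fps (\<lambda>m. poly (map_poly of_real (P m)) z) *
    ((1 - fps_X) ^ n + fps_const (z :: complex) * fps_X ^ r) = 1"
  using generated_by_evaluate[OF assms, of "\<lambda>p. poly (map_poly of_real p) z"]
  by (simp add: map_poly_of_real_add map_poly_of_real_mult map_poly_pCons)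

lemma generated_by_real:
  assumes "generated_by n r P"
  shows "Abs_fps (\<lambda>m. poly (P m) z) * ((1 - fps_X) ^ n + fps_const z * fps_X ^ r) = 1"
  using generated_by_evaluate[OF assms, of "\<lambda>p. poly p z"] by simp

lemma zeros_in_interval:
  assumes n: "n > 0" and r: "r > 0" and nr: "max r n > 1" and gen: "generated_by n r P"
  shows "complex_zeros (P m) \<subseteq> complex_of_real ` zero_interval n r"
proof
  fix z assume "z \<in> complex_zeros (P m)"
  then have z: "poly (map_poly complex_of_real (P m)) z = 0"
    by (simp add: complex_zeros_def)
  have upper: "poly (map_poly complex_of_real (P m)) y \<noteq> 0" if "Im y < 0" for y
    using coeff_nonzero_upper[of "Abs_fps (\<lambda>m. poly (map_poly of_real (P m)) y)" n "- y" r m]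
      generated_by_complex[OF gen, of y] n r that by simp
  have "Im z = 0"
    using upper[of z] upper[of "cnj z"] z poly_map_poly_of_real_cnj[of "P m" z]
    by (cases "Im z" "0::real" rule: linorder_cases) auto
  then have zx: "z = of_real (Re z)"
    by (simp add: complex_eq_iff)
  define x where "x = Re z"
  have Px: "poly (P m) x = 0"
    using z poly_map_poly_of_real[of "P m" x] zx by (simp add: x_def)
  note F = generated_by_real[OF gen, of x]
  have x: "x > 0"
    using coeff_pos_nonpos[OF F n r, of m] Px by (simp add: not_less[symmetric]) blast
  moreover have "x < real n ^ n / real (n - 1) ^ (n - 1)" if "r = 1"
    using coeff_nonzero_linear[of "Abs_fps (\<lambda>m. poly (P m) x)" n x m] F that Px nr by (auto simp: not_less[symmetric] max_def split: if_splits)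
  moreover have "real (r - 1) ^ (r - 1) / real r ^ r < x" if "n = 1"
    using coeff_pos_one[of "Abs_fps (\<lambda>m. poly (P m) x)" x r m] F that Px nr x by (auto simp: not_less[symmetric] max_def split: if_splits)
  ultimately have "x \<in> zero_interval n r"
    using zero_interval_iff[OF n r nr] by blast
  then show "z \<in> complex_of_real ` zero_interval n r"
    using zx by (auto simp: x_def)
qed

text \<open>A common root of the denominator and its derivative is 1 or satisfies \<open>r (1 - a) + n a = 0\<close>, hence is real.\<close>
lemma nonreal_root_simple:
  fixes a :: complex
  assumes root: "(1 - a) ^ n + of_real z * a ^ r = 0" and a: "Im a \<noteq> 0" and n: "n > 0" and r: "r > 0"
  shows "poly (pderiv ([:1, - 1:] ^ n + monom (of_real z) r)) a \<noteq> 0"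
proof
  assume "poly (pderiv ([:1, - 1:] ^ n + monom (of_real z) r)) a = 0"
  then have eq: "of_nat r * of_real z * a ^ (r - 1) = of_nat n * (1 - a) ^ (n - 1)"
    by (simp add: pderiv_add pderiv_power pderiv_pCons pderiv_monom poly_monom algebra_simps)
  have pa: "a ^ r = a * a ^ (r - 1)" "(1 - a) ^ n = (1 - a) * (1 - a) ^ (n - 1)"
    using n r by (simp_all add: power_eq_if)
  have "0 = of_nat r * (1 - a) * ((1 - a) ^ n + of_real z * a ^ r)"
    using root by simp
  also have "\<dots> = of_nat r * (1 - a) * (1 - a) ^ n + (1 - a) * a * (of_nat r * of_real z * a ^ (r - 1))"
    by (simp add: pa(1) algebra_simps)
  also have "\<dots> = (1 - a) ^ n * (of_nat r * (1 - a) + of_nat n * a)"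
    unfolding eq by (simp add: pa(2) algebra_simps)
  finally have "of_nat r * (1 - a) + of_nat n * a = 0"
    using a by auto
  then have re: "Re (of_nat r * (1 - a) + of_nat n * a) = 0" and im: "Im (of_nat r * (1 - a) + of_nat n * a) = 0"
    by simp_all
  from im have "(real n - real r) * Im a = 0"
    by (simp add: algebra_simps)
  then have "real n = real r"
    using a by simp
  with re r show False
    by (simp add: algebra_simps)
qed

lemma generated_asymptotics:
  assumes n: "n > 0" and r: "r > 0" and nr: "max r n > 1" and gen: "generated_by n r P"
    and z: "z \<in> zero_interval n r"
  shows "\<exists>\<theta> \<phi> \<tau> c d. admissible n r \<theta> \<phi> \<and> param n r \<theta> \<phi> = z \<and> \<tau> > 0 \<and> c \<noteq> 0 \<and> d \<noteq> 0 \<and>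
    (\<lambda>m. of_real (poly (P m) z * \<tau> ^ m) - (c * cis \<theta> ^ m + d * cnj (cis \<theta>) ^ m)) \<longlonglongrightarrow> 0"
proof -
  obtain \<theta> \<phi> where adm: "admissible n r \<theta> \<phi>" and pz: "param n r \<theta> \<phi> = z"
    using param_surj[OF n r nr z] by blast
  have pos: "0 < \<theta>" "0 < \<phi>"
    using adm by (auto simp: admissible_def)
  have sum: "\<theta> + \<phi> < pi"
    using admissible_sum_less_pi[OF adm n r nr] .
  define u where "u = apex \<theta> \<phi>"
  define \<tau> where "\<tau> = cmod u"
  define D where "D = [:1, - 1:] ^ n + monom (complex_of_real z) r"
  have Im_u: "Im u > 0"
    unfolding u_def by (rule apex_polar(4)[OF pos sum])
  then have \<tau>: "\<tau> > 0"
    by (auto simp: \<tau>_def)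
  have polyD: "poly D t = (1 - t) ^ n + of_real z * t ^ r" for t
    by (simp add: D_def poly_monom)
  have roots: "poly D u = 0" "poly D (cnj u) = 0"
  proof -
    show u0: "poly D u = 0"
      using apex_root[OF adm sum] by (simp add: polyD u_def pz)
    have "poly D (cnj u) = cnj (poly D u)"
      by (simp add: polyD)
    then show "poly D (cnj u) = 0"
      using u0 by simp
  qed
  have [simp]: "fps_of_poly [:1, - 1 :: complex:] = 1 - fps_X"
    by (simp add: fps_of_poly_linear')
  have "Abs_fps (\<lambda>m. complex_of_real (poly (P m) z)) * fps_of_poly D = 1"
    using generated_by_evaluate[OF gen, of "\<lambda>p. complex_of_real (poly p z)"]
    by (simp add: D_def fps_of_poly_add fps_of_poly_power fps_of_poly_monom)
  moreover have "cnj u \<noteq> u"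
    using Im_u by (auto simp: complex_eq_iff)
  moreover have "poly (pderiv D) u \<noteq> 0" "poly (pderiv D) (cnj u) \<noteq> 0"
    unfolding D_def using roots Im_u n r by (intro nonreal_root_simple; simp add: polyD)+
  moreover have "t = cnj u \<or> t = u" if "poly D t = 0" "cmod t \<le> \<tau>" for t
  proof -
    have "r = 1 \<Longrightarrow> param n r \<theta> \<phi> < real n ^ n / real (n - 1) ^ (n - 1)"
      and "n = 1 \<Longrightarrow> param n r \<theta> \<phi> > real (r - 1) ^ (r - 1) / real r ^ r"
      using z zero_interval_iff[OF n r nr, of z] pz by blast+
    from apex_dominant[OF adm n r nr this, of t] show ?thesis
      using that by (auto simp: polyD pz \<tau>_def u_def)
  qed
  moreover have "cmod (cnj u) = \<tau>" "cmod u = \<tau>"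
    by (simp_all add: \<tau>_def)
  ultimately obtain c d where cd: "c \<noteq> 0" "d \<noteq> 0" and
    lim: "(\<lambda>m. of_real (poly (P m) z) * of_real \<tau> ^ m - (c * (of_real \<tau> / cnj u) ^ m + d * (of_real \<tau> / u) ^ m)) \<longlonglongrightarrow> 0"
    using two_dominant_roots_asymptotics[of "Abs_fps (\<lambda>m. complex_of_real (poly (P m) z))" D "cnj u" u \<tau>] roots
    by auto
  have u: "u = of_real \<tau> * cis \<theta>"
    using apex_polar(1)[OF pos sum] unfolding \<tau>_def u_def by (simp add: apex_def)
  have "of_real \<tau> / cnj u = cis \<theta>" "of_real \<tau> / u = cnj (cis \<theta>)"
    using \<tau> by (simp_all add: u cis_cnj cis_inverse divide_inverse)
  then show ?thesis
    using adm pz \<tau> cd lim by (intro exI[of _ \<theta>] exI[of _ \<phi>] exI[of _ \<tau>] exI[of _ c] exI[of _ d]) simp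
qed

lemma opposite_signs:
  assumes n: "n > 0" and r: "r > 0" and nr: "max r n > 1" and gen: "generated_by n r P"
    and x: "x \<in> zero_interval n r" and y: "y \<in> zero_interval n r" and ne: "x \<noteq> y"
  shows "\<exists>m. poly (P m) x * poly (P m) y < 0"
proof -
  obtain \<theta> \<phi> \<tau> c d where 1: "admissible n r \<theta> \<phi>" "param n r \<theta> \<phi> = x" "\<tau> > 0" "c \<noteq> 0"
    "(\<lambda>m. of_real (poly (P m) x * \<tau> ^ m) - (c * cis \<theta> ^ m + d * cnj (cis \<theta>) ^ m)) \<longlonglongrightarrow> 0"
    using generated_asymptotics[OF n r nr gen x] by blast
  obtain \<theta>' \<phi>' \<tau>' c' d' where 2: "admissible n r \<theta>' \<phi>'" "param n r \<theta>' \<phi>' = y" "\<tau>' > 0" "d' \<noteq> 0"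
    "(\<lambda>m. of_real (poly (P m) y * \<tau>' ^ m) - (c' * cis \<theta>' ^ m + d' * cnj (cis \<theta>') ^ m)) \<longlonglongrightarrow> 0"
    using generated_asymptotics[OF n r nr gen y] by blast
  have "\<theta> \<noteq> \<theta>'"
  proof
    assume "\<theta> = \<theta>'"
    then have "real r * \<theta> = real r * \<theta>'"
      by simp
    then have "real n * \<phi> = real n * \<phi>'"
      using 1(1) 2(1) unfolding admissible_def by linarith
    then show False
      using n ne 1(2) 2(2) \<open>\<theta> = \<theta>'\<close> by simp
  qed
  moreover have "0 < \<theta>" "\<theta> < pi" "0 < \<theta>'" "\<theta>' < pi"
    using 1(1) 2(1) admissible_sum_less_pi[OF 1(1) n r nr] admissible_sum_less_pi[OF 2(1) n r nr]
    unfolding admissible_def by linarith+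
  ultimately obtain m where "(poly (P m) x * \<tau> ^ m) * (poly (P m) y * \<tau>' ^ m) < 0"
    using oscillating_products_negative[OF 1(5) 2(5) 1(4) 2(4)] by blast
  then have "(poly (P m) x * poly (P m) y) * (\<tau> ^ m * \<tau>' ^ m) < 0"
    by (simp add: ac_simps)
  moreover have "\<tau> ^ m * \<tau>' ^ m > 0"
    using 1(3) 2(3) by simp
  ultimately have "poly (P m) x * poly (P m) y < 0"
    by (meson less_imp_le mult_nonneg_nonneg not_less)
  then show ?thesis
    by blast
qed

theorem theorem1:
  fixes n r :: nat and P :: "nat \<Rightarrow> real poly"
  assumes "n > 0" and "r > 0" and "max r n > 1"
    and "generated_by n r P"
  shows "\<exists>M. (\<forall>m\<ge>M. complex_zeros (P m) \<subseteq> complex_of_real ` zero_interval n r) \<and>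
             complex_of_real ` zero_interval n r \<subseteq> closure (\<Union>m\<in>{M..}. complex_zeros (P m))"
proof (intro exI[of _ 0] conjI allI impI)
  show "complex_zeros (P m) \<subseteq> complex_of_real ` zero_interval n r" for m
    using zeros_in_interval[OF assms] .
  show "complex_of_real ` zero_interval n r \<subseteq> closure (\<Union>m\<in>{0..}. complex_zeros (P m))"
  proof (clarsimp simp: closure_approachable)
    fix x e :: real assume x: "x \<in> zero_interval n r" and e: "e > 0"
    have "open (zero_interval n r)"
      by (simp add: zero_interval_def)
    then obtain d where d: "d > 0" "\<And>y. dist y x < d \<Longrightarrow> y \<in> zero_interval n r"
      using x unfolding open_dist by blast
    define y where "y = x + min d e / 2"
    have y: "y \<in> zero_interval n r" "x < y" "y < x + e"
      using d(1) e by (auto simp: y_def dist_real_def intro!: d(2))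
    then obtain m where "poly (P m) x * poly (P m) y < 0"
      using opposite_signs[OF assms x y(1)] by auto
    then obtain w where w: "x < w" "w < y" "poly (P m) w = 0"
      using poly_IVT[OF y(2)] by blast
    have "complex_of_real w \<in> complex_zeros (P m)"
      using w(3) by (simp add: complex_zeros_def poly_map_poly_of_real)
    moreover have "dist (complex_of_real w) (complex_of_real x) < e"
      using w y(3) by (simp add: dist_norm flip: of_real_diff)
    ultimately show "\<exists>m. \<exists>w\<in>complex_zeros (P m). dist w (complex_of_real x) < e"
      by blast
  qed
qed

end
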